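(* Let $l\ge 2$. For each $j=1,\dots,l$, the sequence of linear maps between principal subspaces $$0\longrightarrow W(\Lambda_j)\stackrel{e^{\lambda^j}}{\longrightarrow}W(\Lambda_0)\stackrel{\mathcal Y_c(e^{\lambda_j},x)}{\longrightarrow}W(\Lambda_j)\longrightarrow 0$$ is exact, where $\lambda^j=\alpha_j-\lambda_j$.
   Context: Let $\mathfrak g=\mathfrak{sl}(l+1,\mathbb C)$ with Cartan subalgebra $\mathfrak h$ of diagonal matrices, simple roots $\alpha_1,\dots,\alpha_l$, positive roots $\Delta_+$, a Chevalley basis with root vectors $x_\alpha$, invariant symmetric bilinear form $\langle\cdot,\cdot\rangle$ with $\langle\alpha_i,\alpha_i\rangle=2$ (used to identify $\mathfrak h\simeq\mathfrak h^*$), fundamental weights $\lambda_1,\dots,\lambda_l$ ($\langle\lambda_i,\alpha_j\rangle=\delta_{ij}$), root lattice $Q$ and weight lattice $P$. Let $\widehat{\mathfrak g}=\mathfrak g\otimes\mathbb C[t,t^{-1}]\oplus\mathbb Cc$ with $c$ central and $[x\otimes t^m,y\otimes t^n]=[x,y]\otimes t^{m+n}+m\langle x,y\rangle\delta_{m+n,0}c$; write $x(m)$ for $x\otimes t^m$ or its action on a module. $\Lambda_0,\dots,\Lambda_l$ are the fundamental weights of $\widehat{\mathfrak g}$. Vertex operator construction. Let $M(1)=U(\widehat{\mathfrak h})\otimes_{U(\mathfrak h\otimes\mathbb C[t]\oplus\mathbb Cc)}\mathbb C$, where $\widehat{\mathfrak h}=\mathfrak h\otimes\mathbb C[t,t^{-1}]\oplus\mathbb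 Cc$, $\mathfrak h\otimes\mathbb C[t]$ acts trivially on $\mathbb C$ and $c$ acts as $1$; as a vector space $M(1)\simeq S(\mathfrak h\otimes t^{-1}\mathbb C[t^{-1}])$. Let $V_P=M(1)\otimes\mathbb C[P]$, where the group algebra $\mathbb C[P]$ has basis $e^\lambda$, $\lambda\in P$. For $h\in\mathfrak h$ and $n\ne0$, $h(n)$ acts on the factor $M(1)$, and $h(0)(v\otimes e^\lambda)=\langle h,\lambda\rangle v\otimes e^\lambda$. For $\lambda\in P$ the operator $e^\lambda=1\otimes e^\lambda$ on $V_P$ is multiplication by $e^\lambda$, i.e. $v\otimes e^\beta\mapsto v\otimes e^{\lambda+\beta}$ (a linear isomorphism with inverse $e^{-\lambda}$); also $x^\lambda(v\otimes e^\beta)=x^{\langle\lambda,\beta\rangle}v\otimes e^\beta$. Fix a central extension of $P$ by a finite cyclic group $A$ of roots of unity, with a corresponding $2$-cocycle $\epsilon:P\times P\to A$ satisfying $\epsilon(\alpha,\beta)\epsilon(\beta,\alpha)^{-1}=(-1)^{\langle\alpha,\beta\rangle}$ for $\alpha,\beta\in Q$; put $c(\lambda,\mu)=\epsilon(\lambda,\mu)\epsilon(\mu,\lambda)^{-1}$ for $\lambda,\mu\in P$ (the commutator map), and let $\epsilon_\lambda$ be the operator given by $\epsilon_\lambda e^\beta=\epsilon(\lambda,\beta)e^\beta$ for $\lambda,\beta\in P$. Define $$Y(e^\lambda,x)=E^-(-\lambda,x)E^+(-\lambda,x)\,\epsilon_\lambda e^\lambda x^\lambda,\qquad E^{\pm}(-\lambda,x)=\exp\Big(\sum_{\pm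 n\ge1}\frac{-\lambda(n)}{n}x^{-n}\Big).$$ $V_P$ is a level $1$ $\widehat{\mathfrak g}$-module in which $x_\alpha(m)$ acts as the coefficient of $x^{-m-1}$ in $Y(e^\alpha,x)$ ($\alpha$ a root). The subspaces $V_Q=M(1)\otimes\mathbb C[Q]=L(\Lambda_0)$ and $V_Qe^{\lambda_j}=M(1)\otimes\mathbb C[Q]e^{\lambda_j}=L(\Lambda_j)$, $1\le j\le l$, are the level $1$ standard $\widehat{\mathfrak g}$-modules with highest weights $\Lambda_0$ and $\Lambda_j$ and highest weight vectors $v_{\Lambda_0}=1\otimes1$ and $v_{\Lambda_j}=1\otimes e^{\lambda_j}$. $L(\Lambda_0)=V_Q$ is a vertex operator algebra and the $L(\Lambda_j)$ are its irreducible modules. Principal subspaces. $\mathfrak n=\sum_{\alpha\in\Delta_+}\mathbb Cx_\alpha$, $\bar{\mathfrak n}=\mathfrak n\otimes\mathbb C[t,t^{-1}]$, and $W(\Lambda_i)=U(\bar{\mathfrak n})\cdot v_{\Lambda_i}\subset L(\Lambda_i)$, $0\le i\le l$. Maps. For $1\le j\le l$, the first map is the restriction to $W(\Lambda_j)$ of the operator $e^{\lambda^j}:V_P\to V_P$, $\lambda^j=\alpha_j-\lambda_j$, viewed as a linear map $W(\Lambda_j)\to W(\Lambda_0)$. For the second map, take a nonzero intertwining operator $\mathcal Y(\cdot,x):L(\Lambda_j)\to\mathrm{Hom}(L(\Lambda_0),L(\Lambda_j))[[x,x^{-1}]]$ of type $\binom{L(\Lambda_j)}{L(\Lambda_j)\;L(\Lambda_0)}$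 for the vertex operator algebra $L(\Lambda_0)$; it is unique up to a scalar and is given, up to a scalar, by $w\mapsto Y(w,x)e^{i\pi\lambda_j}c(\cdot,\lambda_j)$, where $e^{i\pi\lambda_j}(v\otimes e^\beta)=e^{i\pi\langle\lambda_j,\beta\rangle}v\otimes e^\beta$ and $c(\cdot,\lambda_j)(v\otimes e^\beta)=c(\beta,\lambda_j)v\otimes e^\beta$. In particular this gives $\mathcal Y(e^{\lambda_j},x):L(\Lambda_0)\to L(\Lambda_j)[[x,x^{-1}]]$. Let $\mathcal Y_c(e^{\lambda_j},x)$ denote its constant term (the coefficient of $x^0$), with the scalar normalized so that $\mathcal Y_c(e^{\lambda_j},x)v_{\Lambda_0}=v_{\Lambda_j}$. It commutes with the action of $\bar{\mathfrak n}$ and so restricts to a linear map $W(\Lambda_0)\to W(\Lambda_j)$; this is the second map. *)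

theory Defs
  imports Complex_Main "HOL-Library.Multiset" "HOL-Library.Poly_Mapping"
    "HOL-Library.Function_Algebras"
begin

text \<open>
  The Cartan subalgebra of \<open>sl(l+1)\<close> consists of the trace-zero diagonal matrices.  A diagonal
  matrix is given by its entries, a function supported on \<open>{1..l+1}\<close>, and \<open>form l\<close> is the trace
  form.  The dual space is identified with the Cartan subalgebra through this form, so roots and
  weights are such functions too.
\<close>

type_synonym cartan = "nat \<Rightarrow> complex"

definition form :: "nat \<Rightarrow> cartan \<Rightarrow> cartan \<Rightarrow> complex" where
  "form l x y = (\<Sum>k = 1..l + 1. x k * y k)"

definition root_diff :: "nat \<Rightarrow> nat \<Rightarrow> cartan" where
  "root_diff i j = (\<lambda>k. of_bool (k = i) - of_bool (k = j))"

definition simple_root :: "nat \<Rightarrow> cartan" where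
  "simple_root i = root_diff i (i + 1)"

definition pos_roots :: "nat \<Rightarrow> cartan set" where
  "pos_roots l = {root_diff i j | i j. 1 \<le> i \<and> i < j \<and> j \<le> l + 1}"

text \<open>The convention \<open>fund_weight l 0 = 0\<close> lets \<open>j = 0\<close> stand for the basic representation.\<close>

definition fund_weight :: "nat \<Rightarrow> nat \<Rightarrow> cartan" where
  "fund_weight l j = (\<lambda>k. of_bool (k \<in> {1..j}) - of_bool (k \<in> {1..l + 1}) * of_nat j / of_nat (l + 1))"

lemma form_fund_weight_simple_root:
  assumes "i \<in> {1..l}" "j \<in> {1..l}"
  shows "form l (fund_weight l i) (simple_root j) = of_bool (i = j)"
proof -
  have "form l (fund_weight l i) (simple_root j) =
      (\<Sum>k = 1..l + 1. (if k = j then fund_weight l i k else 0)) -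
      (\<Sum>k = 1..l + 1. (if k = j + 1 then fund_weight l i k else 0))"
    unfolding form_def simple_root_def root_diff_def sum_subtractf[symmetric]
    by (rule sum.cong) (auto simp: algebra_simps)
  also have "\<dots> = fund_weight l i j - fund_weight l i (j + 1)"
    using assms by (simp only: sum.delta finite_atLeastAtMost) auto
  also have "\<dots> = of_bool (i = j)"
    using assms by (auto simp: fund_weight_def)
  finally show ?thesis .
qed

definition root_lattice :: "nat \<Rightarrow> cartan set" where
  "root_lattice l = {\<lambda>k. \<Sum>i = 1..l. of_int (m i) * simple_root i k | m :: nat \<Rightarrow> int. True}"

definition weight_lattice :: "nat \<Rightarrow> cartan set" where
  "weight_lattice l = {\<lambda>k. \<Sum>i = 1..l. of_int (m i) * fund_weight l i k | m :: nat \<Rightarrow> int. True}"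

text \<open>
  \<open>M(1)\<close> is the symmetric algebra on the basis vectors \<open>\<alpha>\<^sub>i(-n)\<close> with \<open>1 \<le> i \<le> l\<close> and \<open>n \<ge> 1\<close>; the
  monomials are multisets of pairs \<open>(i, n)\<close>.  The pair \<open>(\<mu>, \<beta>)\<close> indexes the basis vector
  \<open>\<mu> \<otimes> e\<^sup>\<beta>\<close>.  The type \<open>fock\<close> does not bound \<open>i\<close>, \<open>n\<close> and \<open>\<beta>\<close>; this is done by \<open>std_module\<close>.
\<close>

type_synonym fock = "((nat \<times> nat) multiset \<times> cartan) \<Rightarrow>\<^sub>0 complex"

definition scale :: "complex \<Rightarrow> fock \<Rightarrow> fock" where
  "scale c = Poly_Mapping.map ((*) c)"

lemma lookup_scale [simp]: "Poly_Mapping.lookup (scale c v) b = c * Poly_Mapping.lookup v b"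
  by (simp add: scale_def Poly_Mapping.map.rep_eq when_def)

interpretation fock: vector_space scale
  by unfold_locales (auto intro!: poly_mapping_eqI simp: lookup_add algebra_simps)

definition basis_vec :: "(nat \<times> nat) multiset \<Rightarrow> cartan \<Rightarrow> fock" where
  "basis_vec \<mu> \<beta> = Poly_Mapping.single (\<mu>, \<beta>) 1"

definition lin_ext :: "((nat \<times> nat) multiset \<Rightarrow> cartan \<Rightarrow> fock) \<Rightarrow> fock \<Rightarrow> fock" where
  "lin_ext g v = (\<Sum>b \<in> Poly_Mapping.keys v. scale (Poly_Mapping.lookup v b) (g (fst b) (snd b)))"

text \<open>
  \<open>std_module l j\<close> is \<open>L(\<Lambda>\<^sub>j) = M(1) \<otimes> C[Q] e\<^bsup>\<lambda>\<^sub>j\<^esup>\<close>, with highest weight vector \<open>hw_vec l j\<close>.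
\<close>

definition std_module :: "nat \<Rightarrow> nat \<Rightarrow> fock set" where
  "std_module l j = {v. \<forall>(\<mu>, \<beta>) \<in> Poly_Mapping.keys v.
     set_mset \<mu> \<subseteq> {1..l} \<times> {1..} \<and> (\<exists>\<gamma> \<in> root_lattice l. \<beta> = \<gamma> + fund_weight l j)}"

definition hw_vec :: "nat \<Rightarrow> nat \<Rightarrow> fock" where
  "hw_vec l j = basis_vec {#} (fund_weight l j)"

text \<open>
  The operator \<open>h(n)\<close>.  Since \<open>h = (\<Sum>i. \<langle>\<lambda>\<^sub>i, h\<rangle> \<alpha>\<^sub>i)\<close>, for \<open>n < 0\<close> it multiplies by
  \<open>\<Sum>i. \<langle>\<lambda>\<^sub>i, h\<rangle> \<alpha>\<^sub>i(n)\<close>; for \<open>n > 0\<close> it is the derivation of \<open>M(1)\<close> that sends \<open>\<alpha>\<^sub>i(-m)\<close> to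
  \<open>n \<langle>h, \<alpha>\<^sub>i\<rangle>\<close> if \<open>m = n\<close> and to \<open>0\<close> otherwise.
\<close>

definition heis :: "nat \<Rightarrow> cartan \<Rightarrow> int \<Rightarrow> fock \<Rightarrow> fock" where
  "heis l h n =
    (if n < 0 then
       lin_ext (\<lambda>\<mu> \<beta>. \<Sum>i = 1..l.
         scale (form l (fund_weight l i) h) (basis_vec (add_mset (i, nat (- n)) \<mu>) \<beta>))
     else if n = 0 then
       lin_ext (\<lambda>\<mu> \<beta>. scale (form l h \<beta>) (basis_vec \<mu> \<beta>))
     else
       lin_ext (\<lambda>\<mu> \<beta>. \<Sum>i = 1..l.
         scale (of_int n * form l h (simple_root i) * of_nat (count \<mu> (i, nat n)))
           (basis_vec (\<mu> - {#(i, nat n)#}) \<beta>)))"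

definition exp_mult :: "cartan \<Rightarrow> fock \<Rightarrow> fock" where
  "exp_mult \<xi> = lin_ext (\<lambda>\<mu> \<beta>. basis_vec \<mu> (\<xi> + \<beta>))"

text \<open>
  \<open>exp_coeff A k\<close> is the coefficient of \<open>y\<^sup>k\<close> in \<open>exp (\<Sum>n\<ge>1. A n y\<^sup>n)\<close>: the \<open>r\<close>-th power of the
  exponent contributes the compositions of \<open>k\<close> into \<open>r\<close> parts.
\<close>

definition exp_coeff :: "(nat \<Rightarrow> fock \<Rightarrow> fock) \<Rightarrow> nat \<Rightarrow> fock \<Rightarrow> fock" where
  "exp_coeff A k v = (\<Sum>ns \<in> {ns. (\<forall>n \<in> set ns. 1 \<le> n) \<and> sum_list ns = k}.
     scale (1 / fact (length ns)) (foldr A ns v))"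

text \<open>
  \<open>E_minus l \<lambda> p\<close> is the coefficient of \<open>x\<^sup>p\<close> in \<open>E\<^sup>-(-\<lambda>, x)\<close>, and \<open>E_plus l \<lambda> q\<close> the coefficient of
  \<open>x\<^bsup>-q\<^esup>\<close> in \<open>E\<^sup>+(-\<lambda>, x)\<close>.
\<close>

definition E_minus :: "nat \<Rightarrow> cartan \<Rightarrow> nat \<Rightarrow> fock \<Rightarrow> fock" where
  "E_minus l \<xi> = exp_coeff (\<lambda>n v. scale (1 / of_nat n) (heis l \<xi> (- int n) v))"

definition E_plus :: "nat \<Rightarrow> cartan \<Rightarrow> nat \<Rightarrow> fock \<Rightarrow> fock" where
  "E_plus l \<xi> = exp_coeff (\<lambda>n v. scale (- 1 / of_nat n) (heis l \<xi> (int n) v))"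

text \<open>
  A 2-cocycle on the weight lattice with values in the group of \<open>N\<close>-th roots of unity and with the
  prescribed commutator map on the root lattice (on which \<open>form l\<close> is integral).
\<close>

definition lattice_cocycle :: "nat \<Rightarrow> nat \<Rightarrow> (cartan \<Rightarrow> cartan \<Rightarrow> complex) \<Rightarrow> bool" where
  "lattice_cocycle l N \<epsilon> \<longleftrightarrow>
     N \<ge> 1 \<and>
     (\<forall>\<xi> \<in> weight_lattice l. \<forall>\<mu> \<in> weight_lattice l. \<epsilon> \<xi> \<mu> ^ N = 1) \<and>
     (\<forall>\<xi> \<in> weight_lattice l. \<forall>\<mu> \<in> weight_lattice l. \<forall>\<nu> \<in> weight_lattice l.
        \<epsilon> \<xi> \<mu> * \<epsilon> (\<xi> + \<mu>) \<nu> = \<epsilon> \<mu> \<nu> * \<epsilon> \<xi> (\<mu> + \<nu>)) \<and>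
     (\<forall>\<alpha> \<in> root_lattice l. \<forall>\<beta> \<in> root_lattice l. \<forall>n :: int.
        form l \<alpha> \<beta> = of_int n \<longrightarrow> \<epsilon> \<alpha> \<beta> * inverse (\<epsilon> \<beta> \<alpha>) = (- 1) powi n)"

definition commutator_map :: "(cartan \<Rightarrow> cartan \<Rightarrow> complex) \<Rightarrow> cartan \<Rightarrow> cartan \<Rightarrow> complex" where
  "commutator_map \<epsilon> \<xi> \<mu> = \<epsilon> \<xi> \<mu> * inverse (\<epsilon> \<mu> \<xi>)"

text \<open>
  \<open>vop_exp l \<epsilon> \<lambda> r\<close> is the coefficient of \<open>x\<^sup>r\<close> in
  \<open>Y(e\<^sup>\<lambda>, x) = E\<^sup>-(-\<lambda>, x) E\<^sup>+(-\<lambda>, x) \<epsilon>\<^sub>\<lambda> e\<^sup>\<lambda> x\<^sup>\<lambda>\<close>.  As usual, \<open>\<epsilon>\<^sub>\<lambda> e\<^sup>\<lambda>\<close> is read as the action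
  \<open>e\<^sup>\<beta> \<mapsto> \<epsilon>(\<lambda>, \<beta>) e\<^bsup>\<lambda>+\<beta>\<^esup>\<close> of the central extension; the factor \<open>\<epsilon>(\<lambda>, \<lambda>+\<beta>)\<close> would not define a
  representation for a cocycle that is not bimultiplicative.  Exponents are complex numbers because
  \<open>\<langle>\<lambda>, \<beta>\<rangle>\<close> need not be an integer.  Only finitely many terms of each \<open>Sum_any\<close> are nonzero on
  the vectors considered.
\<close>

definition vop_exp :: "nat \<Rightarrow> (cartan \<Rightarrow> cartan \<Rightarrow> complex) \<Rightarrow> cartan \<Rightarrow> complex \<Rightarrow> fock \<Rightarrow> fock" where
  "vop_exp l \<epsilon> \<xi> r = lin_ext (\<lambda>\<mu> \<beta>. Sum_any (\<lambda>(p, q).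
     if of_nat p - of_nat q + form l \<xi> \<beta> = r
     then scale (\<epsilon> \<xi> \<beta>) (E_minus l \<xi> p (E_plus l \<xi> q (basis_vec \<mu> (\<xi> + \<beta>))))
     else 0))"

definition root_op :: "nat \<Rightarrow> (cartan \<Rightarrow> cartan \<Rightarrow> complex) \<Rightarrow> cartan \<Rightarrow> int \<Rightarrow> fock \<Rightarrow> fock" where
  "root_op l \<epsilon> \<alpha> m = vop_exp l \<epsilon> \<alpha> (of_int (- m - 1))"

text \<open>
  \<open>U(\<nn>)\<close> for \<open>\<nn> = \<Sum>\<alpha>. C x\<^sub>\<alpha> \<otimes> C[t, t\<^sup>-\<^sup>1]\<close> is spanned by the products of elements \<open>x\<^sub>\<alpha>(m)\<close>.
\<close>

definition principal_subspace :: "nat \<Rightarrow> (cartan \<Rightarrow> cartan \<Rightarrow> complex) \<Rightarrow> nat \<Rightarrow> fock set" where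
  "principal_subspace l \<epsilon> j = fock.span
     {foldr (\<lambda>(\<alpha>, m). root_op l \<epsilon> \<alpha> m) xs (hw_vec l j) | xs. fst ` set xs \<subseteq> pos_roots l}"

text \<open>
  \<open>vop_list l \<epsilon> \<lambda> [(i\<^sub>1, n\<^sub>1), \<dots>] r\<close> is the coefficient of \<open>x\<^sup>r\<close> in the vertex operator of
  \<open>\<alpha>\<^bsub>i\<^sub>1\<^esub>(-n\<^sub>1) \<cdots> \<otimes> e\<^sup>\<lambda>\<close>, the normally ordered product of \<open>Y(e\<^sup>\<lambda>, x)\<close> and the fields
  \<open>1/(n-1)! (d/dx)\<^bsup>n-1\<^esup> \<alpha>\<^sub>i(x) = \<Sum>m. ((-m-1) gchoose (n-1)) \<alpha>\<^sub>i(m) x\<^bsup>-m-n\<^esup>\<close>.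
  The list order is irrelevant, so \<open>vop\<close> may choose any enumeration of a monomial.
\<close>

primrec vop_list ::
  "nat \<Rightarrow> (cartan \<Rightarrow> cartan \<Rightarrow> complex) \<Rightarrow> cartan \<Rightarrow> (nat \<times> nat) list \<Rightarrow> complex \<Rightarrow> fock \<Rightarrow> fock"
where
  "vop_list l \<epsilon> \<xi> [] r v = vop_exp l \<epsilon> \<xi> r v"
| "vop_list l \<epsilon> \<xi> (a # as) r v = (case a of (i, n) \<Rightarrow> Sum_any (\<lambda>m :: int.
     scale (of_int (- m - 1) gchoose (n - 1))
       (if m < 0
        then heis l (simple_root i) m (vop_list l \<epsilon> \<xi> as (r + of_int m + of_nat n) v)
        else vop_list l \<epsilon> \<xi> as (r + of_int m + of_nat n) (heis l (simple_root i) m v))))"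

definition vop :: "nat \<Rightarrow> (cartan \<Rightarrow> cartan \<Rightarrow> complex) \<Rightarrow> fock \<Rightarrow> complex \<Rightarrow> fock \<Rightarrow> fock" where
  "vop l \<epsilon> w r v = lin_ext (\<lambda>\<mu> \<xi>. vop_list l \<epsilon> \<xi> (SOME as. mset as = \<mu>) r v) w"

text \<open>
  The Virasoro operator \<open>L(-1)\<close> of the conformal vector \<open>\<omega> = 1/2 (\<Sum>i. \<lambda>\<^sub>i(-1) \<alpha>\<^sub>i(-1) 1)\<close>, that is,
  \<open>1/2 (\<Sum>i. \<Sum>n. :\<lambda>\<^sub>i(-1-n) \<alpha>\<^sub>i(n):)\<close>.
\<close>

definition vir_L_minus1 :: "nat \<Rightarrow> fock \<Rightarrow> fock" where
  "vir_L_minus1 l v = scale (1 / 2) (\<Sum>i = 1..l. Sum_any (\<lambda>n :: int.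
     if n < 0
     then heis l (simple_root i) n (heis l (fund_weight l i) (- 1 - n) v)
     else heis l (fund_weight l i) (- 1 - n) (heis l (simple_root i) n v)))"

definition linear_between :: "fock set \<Rightarrow> fock set \<Rightarrow> (fock \<Rightarrow> fock) \<Rightarrow> bool" where
  "linear_between A B f \<longleftrightarrow>
     f ` A \<subseteq> B \<and>
     (\<forall>v \<in> A. \<forall>w \<in> A. f (v + w) = f v + f w) \<and>
     (\<forall>c. \<forall>v \<in> A. f (scale c v) = scale c (f v))"

text \<open>
  Intertwining operators of type \<open>(W\<^sub>3 / W\<^sub>1 W\<^sub>2)\<close> with integral powers of \<open>x\<close>, for the vertex
  operator algebra \<open>L(\<Lambda>\<^sub>0)\<close> and modules contained in \<open>V\<^sub>P\<close>.  Here \<open>Z w k\<close> is the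
  coefficient of \<open>x\<^sup>k\<close>.  The Jacobi identity is stated by comparing the coefficients of
  \<open>x\<^sub>0\<^bsup>-k-1\<^esup> x\<^sub>1\<^bsup>-m-1\<^esup> x\<^sub>2\<^bsup>-n-1\<^esup>\<close>.
\<close>

definition jacobi_identity ::
  "nat \<Rightarrow> (cartan \<Rightarrow> cartan \<Rightarrow> complex) \<Rightarrow> (fock \<Rightarrow> int \<Rightarrow> fock \<Rightarrow> fock) \<Rightarrow> fock \<Rightarrow> fock \<Rightarrow> fock \<Rightarrow> bool"
where
  "jacobi_identity l \<epsilon> Z u w v \<longleftrightarrow> (\<forall>k m n :: int.
     let U = (\<lambda>a. vop l \<epsilon> u (of_int (- a - 1)));
         W = (\<lambda>w' a. Z w' (- a - 1))
     in Sum_any (\<lambda>i :: nat. scale ((- 1) ^ i * (of_int k gchoose i))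
            (U (k + m - int i) (W w (n + int i) v)))
        - Sum_any (\<lambda>i :: nat. scale ((- 1) powi k * (- 1) ^ i * (of_int k gchoose i))
            (W w (k + n - int i) (U (m + int i) v)))
      = Sum_any (\<lambda>i :: nat. scale (of_int m gchoose i)
            (W (U (k + int i) w) (m + n - int i) v)))"

definition intertwining_operator ::
  "nat \<Rightarrow> (cartan \<Rightarrow> cartan \<Rightarrow> complex) \<Rightarrow> fock set \<Rightarrow> fock set \<Rightarrow> fock set \<Rightarrow>
   (fock \<Rightarrow> int \<Rightarrow> fock \<Rightarrow> fock) \<Rightarrow> bool"
where
  "intertwining_operator l \<epsilon> W1 W2 W3 Z \<longleftrightarrow>
     (\<forall>w \<in> W1. \<forall>k. linear_between W2 W3 (Z w k)) \<and>
     (\<forall>v \<in> W2. \<forall>k. linear_between W1 W3 (\<lambda>w. Z w k v)) \<and>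
     (\<forall>w \<in> W1. \<forall>v \<in> W2. \<exists>K. \<forall>k < K. Z w k v = 0) \<and>
     (\<forall>u \<in> std_module l 0. \<forall>w \<in> W1. \<forall>v \<in> W2. jacobi_identity l \<epsilon> Z u w v) \<and>
     (\<forall>w \<in> W1. \<forall>v \<in> W2. \<forall>k. Z (vir_L_minus1 l w) k v = scale (of_int (k + 1)) (Z w (k + 1) v))"

text \<open>
  \<open>std_intertwiner l \<epsilon> j w k\<close> is the coefficient of \<open>x\<^sup>k\<close> in
  \<open>Y(w, x) e\<^bsup>i\<pi>\<lambda>\<^sub>j\<^esup> c(\<cdot>, \<lambda>\<^sub>j)\<close>.
\<close>

definition std_intertwiner ::
  "nat \<Rightarrow> (cartan \<Rightarrow> cartan \<Rightarrow> complex) \<Rightarrow> nat \<Rightarrow> fock \<Rightarrow> int \<Rightarrow> fock \<Rightarrow> fock"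
where
  "std_intertwiner l \<epsilon> j w k v = vop l \<epsilon> w (of_int k)
     (lin_ext (\<lambda>\<mu> \<beta>. scale (exp (\<i> * of_real pi * form l (fund_weight l j) \<beta>)
        * commutator_map \<epsilon> \<beta> (fund_weight l j)) (basis_vec \<mu> \<beta>)) v)"

definition short_exact ::
  "fock set \<Rightarrow> (fock \<Rightarrow> fock) \<Rightarrow> fock set \<Rightarrow> (fock \<Rightarrow> fock) \<Rightarrow> fock set \<Rightarrow> bool"
where
  "short_exact A f B g C \<longleftrightarrow>
     linear_between A B f \<and> linear_between B C g \<and>
     inj_on f A \<and> f ` A = {b \<in> B. g b = 0} \<and> g ` B = C"

end

theory Submission
  imports Defs "HOL-Library.Product_Plus"
begin

text \<open>
  On \<open>M(1)\<close> let \<open>H\<^sub>i(z) = exp (\<Sum>n\<ge>1. \<alpha>\<^sub>i(-n) z\<^sup>n / n)\<close>; its coefficients \<open>H\<^sub>i\<^sub>,\<^sub>n\<close> with \<open>n \<ge> 1\<close> are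
  algebraically independent, and \<open>H\<^sub>i\<^sub>,\<^sub>0 = 1\<close>.  Since \<open>\<nn>\<close> is generated by the simple root vectors and all
  modes are available, the part of \<open>W(\<Lambda>\<^sub>j)\<close> of weight \<open>\<lambda>\<^sub>j + \<Sum>k\<^sub>i\<alpha>\<^sub>i\<close> is spanned by the products of exactly
  \<open>k\<^sub>i\<close> factors \<open>H\<^sub>i\<^sub>,\<^sub>n\<close>, \<open>n \<ge> 0\<close>, for each \<open>i\<close>: the leading term of \<open>x\<^bsub>\<alpha>\<^sub>i\<^esub>(m)\<close> multiplies by some
  \<open>H\<^sub>i\<^sub>,\<^sub>n\<close>, and its other terms lower the degree of the vector acted on.  In this description \<open>e\<^bsup>\<lambda>\<^sup>j\<^esup>\<close>
  inserts a factor \<open>H\<^sub>j\<^sub>,\<^sub>0 = 1\<close>, while \<open>Y\<^sub>c(e\<^bsup>\<lambda>\<^sub>j\<^esup>, x)\<close> replaces every factor \<open>H\<^sub>j\<^sub>,\<^sub>n\<close> by \<open>H\<^sub>j\<^sub>,\<^sub>n\<^sub>-\<^sub>1\<close>, with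
  \<open>H\<^sub>j\<^sub>,\<^sub>-\<^sub>1 = 0\<close>.  By independence its kernel is spanned by the products having a factor \<open>H\<^sub>j\<^sub>,\<^sub>0\<close>.
\<close>

section \<open>Linear algebra of the Fock space\<close>

text \<open>The second map is known in two ways, through the axioms of a normalized intertwining
  operator and through an explicit vertex operator. On vectors of a given weight either one is the
  index shift only up to a scalar made of cocycle values and phases. That scalar depends on the
  weight alone and never vanishes, so exactness is proved once, for any map of the form scalar times
  shift. For an abstract operator the scalar is found by induction on the weight: the constant term
  commutes with all \<open>x_{alpha_i}(m)\<close>, and these generate the space from the highest
  weight vector. As \<open>H_{i,0} = 1\<close>, a product does not show how many factors it has.
  Products are therefore indexed by multisets that keep the factors of index 0, and the lattice
  weight recovers their number. Independence rests on polynomial degree: \<open>n H_{i,n}\<close> is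
  \<open>alpha_i(-n)\<close> plus products of at least two generators. The shift is found inside the
  vertex operator because \<open>E^+(-lambda_j, x)\<close> is multiplicative, fixes
  \<open>H_i(z)\<close> for \<open>i\<close> different from \<open>j\<close> and multiplies
  \<open>H_j(z)\<close> by \<open>1 - z/x\<close>.\<close>

declare plus_fun_apply [simp del] zero_fun_apply [simp del]

interpretation fock_pair: vector_space_pair scale scale ..

abbreviation fock_linear :: "(fock \<Rightarrow> fock) \<Rightarrow> bool" where
  "fock_linear \<equiv> Vector_Spaces.linear scale scale"

lemma fock_linearI:
  "(\<And>v w. f (v + w) = f v + f w) \<Longrightarrow> (\<And>c v. f (scale c v) = scale c (f v)) \<Longrightarrow> fock_linear f"
  by (simp add: Vector_Spaces.linear_iff fock.vector_space_axioms)

text \<open>Addition of index pairs is componentwise, so \<open>fock\<close> carries the convolution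
  product of a monoid algebra: it is the commutative ring of polynomials in the
  \<open>alpha_i(-n)\<close> tensored with a group algebra. Scalars are the elements supported at
  index 0, and most operators below become multiplications or derivations of this ring.\<close>

lemma scale_eq_mult: "scale c v = Poly_Mapping.single 0 c * v"
  by (simp add: scale_def mult_map_scale_conv_mult)

lemma scale_mult_left: "scale c v * w = scale c (v * w)"
  by (simp add: scale_eq_mult mult.assoc)

lemma scale_mult_right: "v * scale c w = scale c (v * w)"
  by (simp add: scale_eq_mult mult.left_commute)

lemma scale_of_nat: "scale (of_nat n) v = of_nat n * v"
  by (simp add: scale_eq_mult)

lemma scale_cancel: "c \<noteq> 0 \<Longrightarrow> scale c v = scale c w \<Longrightarrow> v = w"
  by (metis fock.scale_left_imp_eq)

lemma basis_vec_mult: "basis_vec \<mu> \<beta> * basis_vec \<nu> \<gamma> = basis_vec (\<mu> + \<nu>) (\<beta> + \<gamma>)"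
  by (simp add: basis_vec_def mult_single)

lemma basis_vec_one: "basis_vec {#} 0 = 1"
  by (simp add: basis_vec_def flip: single_one zero_prod_def)

lemma fock_expansion:
  "v = (\<Sum>b \<in> Poly_Mapping.keys v. scale (Poly_Mapping.lookup v b) (basis_vec (fst b) (snd b)))"
proof (rule poly_mapping_eqI)
  fix k
  show "Poly_Mapping.lookup v k = Poly_Mapping.lookup (\<Sum>b \<in> Poly_Mapping.keys v. scale (Poly_Mapping.lookup v b) (basis_vec (fst b) (snd b))) k"
    by (simp add: lookup_sum basis_vec_def lookup_single when_def in_keys_iff if_distrib cong: if_cong)
qed

lemma fock_linear_lin_ext: "fock_linear (lin_ext g)"
proof -
  \<comment> \<open>Supports of sums can shrink, so the defining sum is first allowed to run over
    any finite superset of the support.\<close>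
  have ext: "lin_ext g v = (\<Sum>b\<in>S. scale (Poly_Mapping.lookup v b) (g (fst b) (snd b)))"
    if "finite S" "Poly_Mapping.keys v \<subseteq> S" for v S
    unfolding lin_ext_def using that by (intro sum.mono_neutral_left) (auto simp: in_keys_iff)
  show ?thesis
  proof (rule fock_linearI)
    fix v w :: fock
    let ?S = "Poly_Mapping.keys v \<union> Poly_Mapping.keys w"
    have "Poly_Mapping.keys (v + w) \<subseteq> ?S" by (rule Poly_Mapping.keys_add)
    then show "lin_ext g (v + w) = lin_ext g v + lin_ext g w"
      by (subst (1 2 3) ext[where S = ?S]) (auto simp: lookup_add fock.scale_left_distrib sum.distrib)
  next
    fix c and v :: fock
    have "Poly_Mapping.keys (scale c v) \<subseteq> Poly_Mapping.keys v" by (auto simp: in_keys_iff)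
    then show "lin_ext g (scale c v) = scale c (lin_ext g v)"
      by (subst (1 2) ext[where S = "Poly_Mapping.keys v"]) (auto simp: fock.scale_sum_right)
  qed
qed

lemma lin_ext_basis_vec [simp]: "lin_ext g (basis_vec \<mu> \<beta>) = g \<mu> \<beta>"
  by (simp add: lin_ext_def basis_vec_def)

lemma fock_linear_eqI:
  assumes "fock_linear f" "fock_linear g" "\<And>\<mu> \<beta>. f (basis_vec \<mu> \<beta>) = g (basis_vec \<mu> \<beta>)"
  shows "f v = g v"
  by (subst (1 2) fock_expansion[of v])
     (simp add: fock_pair.linear_sum[OF assms(1)] fock_pair.linear_sum[OF assms(2)]
        fock_pair.linear_scale[OF assms(1)] fock_pair.linear_scale[OF assms(2)] assms(3))

lemma fock_linear_mult: "fock_linear ((*) a)"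
  by (rule fock_linearI) (auto simp: scale_mult_right distrib_left)

lemma fock_linear_mult': "fock_linear (\<lambda>v. v * a)"
  by (rule fock_linearI) (auto simp: scale_mult_left distrib_right)

lemma fock_linear_compose: "fock_linear f \<Longrightarrow> fock_linear g \<Longrightarrow> fock_linear (\<lambda>v. f (g v))"
  using Vector_Spaces.linear_compose[of scale scale g scale f] by (simp add: o_def)

lemma fock_linear_scale: "fock_linear (scale c)"
  by (rule fock_linearI) (auto simp: fock.scale_right_distrib mult.commute)

lemma fock_linear_sum: "(\<And>i. i \<in> I \<Longrightarrow> fock_linear (f i)) \<Longrightarrow> fock_linear (\<lambda>v. \<Sum>i\<in>I. f i v)"
  by (rule fock_pair.linear_compose_sum) auto

lemma fock_linear_id: "fock_linear (\<lambda>v. v)"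
  by (rule fock_linearI) auto

lemmas fock_linear_intros = fock_linear_lin_ext fock_linear_mult fock_linear_mult'
  fock_linear_scale fock_linear_sum fock_linear_id

definition expo :: "cartan \<Rightarrow> fock" where
  "expo \<beta> = basis_vec {#} \<beta>"

lemma expo_mult: "expo \<beta> * expo \<gamma> = expo (\<beta> + \<gamma>)"
  by (simp add: expo_def basis_vec_mult)

lemma expo_0: "expo 0 = 1"
  by (simp add: expo_def basis_vec_one)

lemma exp_mult_eq: "exp_mult \<xi> v = expo \<xi> * v"
  unfolding exp_mult_def
  by (rule fock_linear_eqI[where g = "(*) (expo \<xi>)"]) (auto intro!: fock_linear_intros simp: expo_def basis_vec_mult)

definition gen :: "nat \<times> nat \<Rightarrow> fock" where
  "gen x = basis_vec {#x#} 0"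

definition partial_deriv :: "nat \<times> nat \<Rightarrow> fock \<Rightarrow> fock" where
  "partial_deriv x = lin_ext (\<lambda>\<mu> \<beta>. scale (of_nat (count \<mu> x)) (basis_vec (\<mu> - {#x#}) \<beta>))"

lemma fock_linear_partial_deriv: "fock_linear (partial_deriv x)"
  unfolding partial_deriv_def by (rule fock_linear_lin_ext)

lemma partial_deriv_basis_vec: "partial_deriv x (basis_vec \<mu> \<beta>) = scale (of_nat (count \<mu> x)) (basis_vec (\<mu> - {#x#}) \<beta>)"
  by (simp add: partial_deriv_def)

lemma partial_deriv_commute: "partial_deriv x (partial_deriv y v) = partial_deriv y (partial_deriv x v)"
proof (rule fock_linear_eqI[where f = "\<lambda>v. partial_deriv x (partial_deriv y v)"])
  fix \<mu> \<beta>
  show "partial_deriv x (partial_deriv y (basis_vec \<mu> \<beta>)) = partial_deriv y (partial_deriv x (basis_vec \<mu> \<beta>))"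
    by (cases "x = y") (simp_all add: partial_deriv_basis_vec fock_pair.linear_scale[OF fock_linear_partial_deriv] add_mset_commute mult.commute)
qed (rule fock_linear_compose[OF fock_linear_partial_deriv fock_linear_partial_deriv])+

lemma partial_deriv_mult: "partial_deriv x (v * w) = partial_deriv x v * w + v * partial_deriv x w"
proof -
  have bb: "partial_deriv x (basis_vec \<mu> \<beta> * basis_vec \<nu> \<gamma>)
      = partial_deriv x (basis_vec \<mu> \<beta>) * basis_vec \<nu> \<gamma> + basis_vec \<mu> \<beta> * partial_deriv x (basis_vec \<nu> \<gamma>)" for \<mu> \<beta> \<nu> \<gamma>
  proof -
    \<comment> \<open>When \<open>x\<close> is absent from \<open>\<mu>\<close> both coefficients
      are 0, so the truncated multiset difference causes no error.\<close>
    have 1: "scale (of_nat (count \<mu> x)) (basis_vec (\<mu> + \<nu> - {#x#}) \<delta>)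
        = scale (of_nat (count \<mu> x)) (basis_vec ((\<mu> - {#x#}) + \<nu>) \<delta>)" for \<mu> \<nu> \<delta>
      by (cases "x \<in># \<mu>") (auto simp: count_eq_zero_iff)
    have 2: "scale (of_nat (count \<nu> x)) (basis_vec (\<mu> + \<nu> - {#x#}) \<delta>)
        = scale (of_nat (count \<nu> x)) (basis_vec (\<mu> + (\<nu> - {#x#})) \<delta>)" for \<delta>
      using 1[of \<nu> \<mu>] by (simp only: add.commute)
    show ?thesis
      by (simp only: partial_deriv_basis_vec basis_vec_mult scale_mult_left scale_mult_right count_union
          of_nat_add fock.scale_left_distrib 1 2)
  qed
  have b: "partial_deriv x (basis_vec \<mu> \<beta> * w) = partial_deriv x (basis_vec \<mu> \<beta>) * w + basis_vec \<mu> \<beta> * partial_deriv x w" for \<mu> \<beta>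
    by (rule fock_linear_eqI[where f = "\<lambda>w. partial_deriv x (basis_vec \<mu> \<beta> * w)"])
       (auto intro!: fock_linear_compose[OF fock_linear_partial_deriv] fock_pair.linear_compose_add
          fock_linear_compose[OF fock_linear_mult] fock_linear_intros fock_linear_partial_deriv simp: bb)
  show ?thesis
    by (rule fock_linear_eqI[where f = "\<lambda>v. partial_deriv x (v * w)"])
       (auto intro!: fock_linear_compose[OF fock_linear_partial_deriv] fock_pair.linear_compose_add
          fock_linear_compose[OF fock_linear_mult'] fock_linear_intros fock_linear_partial_deriv simp: b)
qed

lemma partial_deriv_expo: "partial_deriv x (expo \<beta>) = 0"
  by (simp add: expo_def partial_deriv_basis_vec)

lemma partial_deriv_gen: "partial_deriv x (gen y) = (if x = y then 1 else 0)"
  by (simp add: gen_def partial_deriv_basis_vec basis_vec_one)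

section \<open>Heisenberg operators as multiplications and derivations\<close>

definition hneg :: "nat \<Rightarrow> cartan \<Rightarrow> nat \<Rightarrow> fock" where
  "hneg l \<xi> n = (\<Sum>i = 1..l. scale (form l (fund_weight l i) \<xi>) (gen (i, n)))"

definition hpos :: "nat \<Rightarrow> cartan \<Rightarrow> nat \<Rightarrow> fock \<Rightarrow> fock" where
  "hpos l \<xi> n v = (\<Sum>i = 1..l. scale (of_nat n * form l \<xi> (simple_root i)) (partial_deriv (i, n) v))"

lemma heis_neg: "n \<ge> 1 \<Longrightarrow> heis l \<xi> (- int n) v = hneg l \<xi> n * v"
proof -
  assume "n \<ge> 1"
  then have "heis l \<xi> (- int n) = lin_ext (\<lambda>\<mu> \<beta>. \<Sum>i = 1..l.
         scale (form l (fund_weight l i) \<xi>) (basis_vec (add_mset (i, n) \<mu>) \<beta>))"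
    by (simp add: heis_def)
  then show ?thesis
    by (simp only:) (rule fock_linear_eqI[where g = "(*) (hneg l \<xi> n)"], auto intro!: fock_linear_intros
        simp: hneg_def sum_distrib_right scale_mult_left gen_def basis_vec_mult)
qed

lemma heis_pos: "n \<ge> 1 \<Longrightarrow> heis l \<xi> (int n) v = hpos l \<xi> n v"
proof -
  assume "n \<ge> 1"
  then have "heis l \<xi> (int n) = lin_ext (\<lambda>\<mu> \<beta>. \<Sum>i = 1..l.
         scale (of_nat n * form l \<xi> (simple_root i) * of_nat (count \<mu> (i, n)))
           (basis_vec (\<mu> - {#(i, n)#}) \<beta>))"
    by (simp add: heis_def)
  then show ?thesis
    unfolding hpos_def
    by (simp only:) (rule fock_linear_eqI[where f = "lin_ext _"], auto intro!: fock_linear_intros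
        fock_linear_compose[OF fock_linear_scale fock_linear_partial_deriv]
        simp: partial_deriv_basis_vec)
qed

lemma fock_linear_hpos: "fock_linear (hpos l \<xi> n)"
  unfolding hpos_def
  by (auto intro!: fock_linear_intros fock_linear_compose[OF fock_linear_scale fock_linear_partial_deriv])

lemma hpos_commute: "hpos l \<xi> n (hpos l \<eta> m v) = hpos l \<eta> m (hpos l \<xi> n v)"
proof -
  have "hpos l \<xi> n (hpos l \<eta> m v) = (\<Sum>i = 1..l. \<Sum>i' = 1..l.
     scale (of_nat n * form l \<xi> (simple_root i)) (scale (of_nat m * form l \<eta> (simple_root i')) (partial_deriv (i, n) (partial_deriv (i', m) v))))"
    for \<xi> \<eta> n m
    by (simp only: hpos_def fock_pair.linear_sum[OF fock_linear_partial_deriv] fock_pair.linear_scale[OF fock_linear_partial_deriv]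
       fock.scale_sum_right)
  then show ?thesis
    by (simp only:) (subst sum.swap, auto intro!: sum.cong simp: partial_deriv_commute[of "(_, n)"] mult.commute mult.left_commute)
qed

lemma hpos_mult: "hpos l \<xi> n (v * w) = hpos l \<xi> n v * w + v * hpos l \<xi> n w"
  by (simp add: hpos_def partial_deriv_mult fock.scale_right_distrib sum.distrib sum_distrib_right sum_distrib_left
     scale_mult_left scale_mult_right)

lemma hpos_expo: "hpos l \<xi> n (expo \<beta>) = 0"
  by (simp add: hpos_def partial_deriv_expo)

lemma hneg_simple_root: "i \<in> {1..l} \<Longrightarrow> hneg l (simple_root i) n = gen (i, n)"
proof -
  assume i: "i \<in> {1..l}"
  have "hneg l (simple_root i) n = (\<Sum>k = 1..l. if k = i then gen (k, n) else 0)"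
    unfolding hneg_def by (rule sum.cong) (use i in \<open>auto simp: form_fund_weight_simple_root\<close>)
  with i show ?thesis by simp
qed

text \<open>This is the Heisenberg relation
  \<open>[xi(n), alpha_i(-m)] = n <xi, alpha_i> delta_{n,m}\<close>, obtained by evaluating a
  derivation on a generator.\<close>

lemma hpos_hneg:
  assumes i: "i \<in> {1..l}" and "n \<ge> 1" "m \<ge> 1"
  shows "hpos l \<xi> n (hneg l (simple_root i) m) = (if n = m then scale (of_nat n * form l \<xi> (simple_root i)) 1 else 0)"
proof -
  have "hpos l \<xi> n (hneg l (simple_root i) m) = (\<Sum>k = 1..l. if k = i then (if n = m then scale (of_nat n * form l \<xi> (simple_root k)) 1 else 0) else 0)"
    unfolding hneg_simple_root[OF i] hpos_def by (rule sum.cong) (auto simp: partial_deriv_gen)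
  with i show ?thesis by simp
qed

section \<open>Exponential series\<close>

definition compositions :: "nat \<Rightarrow> nat list set" where
  "compositions k = {ns. (\<forall>n \<in> set ns. 1 \<le> n) \<and> sum_list ns = k}"

lemma length_le_sum_list: "(\<forall>n \<in> set ns. 1 \<le> n) \<Longrightarrow> length ns \<le> sum_list (ns :: nat list)"
  by (induction ns) auto

lemma finite_compositions: "finite (compositions k)"
proof (rule finite_subset)
  show "compositions k \<subseteq> {ns. set ns \<subseteq> {..k} \<and> length ns \<le> k}"
    using length_le_sum_list member_le_sum_list by (fastforce simp: compositions_def)
  show "finite {ns. set ns \<subseteq> {..k} \<and> length ns \<le> k}"
    by (rule finite_lists_length_le) simp
qed

lemma compositions_0: "compositions 0 = {[]}"
proof -
  have "ns = []" if "ns \<in> compositions 0" for ns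
    using that by (cases ns) (auto simp: compositions_def)
  then show ?thesis by (auto simp: compositions_def)
qed

lemma exp_coeff_compositions: "exp_coeff A k v = (\<Sum>ns\<in>compositions k. scale (1 / fact (length ns)) (foldr A ns v))"
  by (simp add: exp_coeff_def compositions_def)

lemma foldr_rotate:
  assumes "\<And>m n v. A m (A n v) = A n (A m v)"
  shows "foldr A (rotate i ns) v = foldr A ns v"
proof -
  have 1: "foldr A ns (A n v) = A n (foldr A ns v)" for n ns v
    by (induction ns) (auto simp: assms)
  have "foldr A (rotate1 ns) v = foldr A ns v" for ns
    by (cases ns) (auto simp: 1)
  then show ?thesis by (induction i) auto
qed

lemma sum_list_rotate: "sum_list (rotate i ns) = sum_list (ns :: nat list)"
proof -
  have "sum_list (rotate1 ns) = sum_list ns" for ns :: "nat list"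
    by (cases ns) auto
  then show ?thesis by (induction i) auto
qed

text \<open>Every position of a composition can be rotated to the front, so for a rotation-invariant
  summand the sum of the parts may be traded for the length times the first part.\<close>

lemma sum_compositions_rotate:
  fixes g :: "nat list \<Rightarrow> fock"
  assumes "\<And>i ns. g (rotate i ns) = g ns"
  shows "(\<Sum>ns\<in>compositions k. scale (of_nat (sum_list ns)) (g ns))
       = (\<Sum>ns\<in>compositions k. scale (of_nat (length ns * hd ns)) (g ns))"
proof -
  let ?S = "SIGMA ns:compositions k. {..<length ns}"
  have "(\<Sum>ns\<in>compositions k. scale (of_nat (sum_list ns)) (g ns)) = (\<Sum>(ns, i)\<in>?S. scale (of_nat (ns ! i)) (g ns))"
    by (subst sum.Sigma[symmetric])
       (auto simp: finite_compositions sum_list_sum_nth fock.scale_sum_left atLeast0LessThan)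
  also have "\<dots> = (\<Sum>(ns, i)\<in>?S. scale (of_nat (hd ns)) (g ns))"
  proof (rule sum.reindex_bij_witness[where i = "\<lambda>(ns, i). (rotate (length ns - i) ns, i)" and j = "\<lambda>(ns, i). (rotate i ns, i)"], goal_cases)
    case (5 a)
    then obtain ns i where a: "a = (ns, i)" "i < length ns" by auto
    then have "ns \<noteq> []" by auto
    then show ?case using hd_rotate_conv_nth[of ns i] a by (simp add: assms)
  qed (auto simp: rotate_rotate compositions_def sum_list_rotate)
  also have "\<dots> = (\<Sum>ns\<in>compositions k. scale (of_nat (length ns * hd ns)) (g ns))"
    by (subst sum.Sigma[symmetric])
       (auto simp: finite_compositions scale_of_nat[symmetric] intro!: sum.cong)
  finally show ?thesis .
qed

lemma exp_coeff_0 [simp]: "exp_coeff A 0 v = v"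
  by (simp add: exp_coeff_compositions compositions_0)

text \<open>This is \<open>y d/dy exp A = (y dA/dy) exp A\<close> read off at \<open>y^k\<close>,
  valid because the \<open>A n\<close> commute. With the value at index 0 it determines all
  coefficients, since a nonzero index can be cancelled; the identities between exponential series
  below are proved from it by strong induction.\<close>

lemma exp_coeff_rec:
  assumes lin: "\<And>n. fock_linear (A n)" and comm: "\<And>m n v. A m (A n v) = A n (A m v)"
  shows "scale (of_nat k) (exp_coeff A k v) = (\<Sum>n = 1..k. scale (of_nat n) (A n (exp_coeff A (k - n) v)))"
proof (cases "k = 0")
  case False
  have "scale (of_nat k) (exp_coeff A k v)
      = (\<Sum>ns\<in>compositions k. scale (of_nat (sum_list ns)) (scale (1 / fact (length ns)) (foldr A ns v)))"
    unfolding exp_coeff_compositions fock.scale_sum_right by (rule sum.cong) (auto simp: compositions_def)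
  also have "\<dots> = (\<Sum>ns\<in>compositions k. scale (of_nat (length ns * hd ns)) (scale (1 / fact (length ns)) (foldr A ns v)))"
    by (rule sum_compositions_rotate) (simp add: foldr_rotate[of A, OF comm])
  also have "\<dots> = (\<Sum>(n, ns)\<in>(SIGMA n:{1..k}. compositions (k - n)).
       scale (of_nat n) (A n (scale (1 / fact (length ns)) (foldr A ns v))))"
  proof (rule sum.reindex_bij_witness[where i = "\<lambda>(n, ns). n # ns" and j = "\<lambda>ns. (hd ns, tl ns)"], goal_cases)
    case (1 ns) with False show ?case by (cases ns) (auto simp: compositions_def)
  next
    case (2 ns) with False show ?case by (cases ns) (auto simp: compositions_def)
  next
    case (5 ns)
    with False obtain n ns' where ns: "ns = n # ns'" by (cases ns) (auto simp: compositions_def)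
    \<comment> \<open>The factor \<open>length\<close> turns \<open>1 / (m + 1)!\<close> into
      \<open>1 / m!\<close>, the weight of the composition without its head.\<close>
    have "of_nat (Suc m * n) * (1 / fact (Suc m)) = of_nat n * (1 / fact m :: complex)" for m
      by (simp only: fact_Suc of_nat_mult) (simp add: divide_simps del: of_nat_Suc)
    from this[of "length ns'"] show ?case by (simp add: ns fock_pair.linear_scale[OF lin])
  qed (auto simp: compositions_def)
  also have "\<dots> = (\<Sum>n = 1..k. scale (of_nat n) (A n (exp_coeff A (k - n) v)))"
    by (subst sum.Sigma[symmetric])
       (auto simp: finite_compositions exp_coeff_compositions fock_pair.linear_sum[OF lin] fock.scale_sum_right)
  finally show ?thesis .
qed simp

lemma fock_linear_exp_coeff:
  assumes lin: "\<And>n. fock_linear (A n)"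
  shows "fock_linear (exp_coeff A k)"
proof -
  have "fock_linear (foldr A ns)" for ns
  proof (induction ns)
    case Nil
    show ?case using fock_linear_id by (simp add: id_def)
  next
    case (Cons n ns)
    from fock_linear_compose[OF lin Cons.IH] show ?case by (simp add: o_def)
  qed
  then show ?thesis unfolding exp_coeff_compositions[abs_def]
    by (intro fock_linear_sum fock_linear_compose[OF fock_linear_scale])
qed

text \<open>Cauchy products: the recursion \<open>q x\<^sub>q = \<Sum> \<dots>\<close> of \<open>exp_coeff_rec\<close> says that a generating function
  satisfies a first-order linear differential equation, and this is Leibniz' rule for it.\<close>

lemma cauchy_product_rec:
  fixes x y :: "nat \<Rightarrow> fock"
  assumes x: "\<And>q. of_nat q * x q = (\<Sum>n = 1..q. X n (q - n))"
      and y: "\<And>q. of_nat q * y q = (\<Sum>n = 1..q. Y n (q - n))"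
  shows "of_nat q * (\<Sum>s\<le>q. x s * y (q - s))
     = (\<Sum>n = 1..q. \<Sum>s\<le>q - n. X n s * y (q - n - s) + x s * Y n (q - n - s))"
proof -
  have "of_nat q * (\<Sum>s\<le>q. x s * y (q - s)) = (\<Sum>s\<le>q. (of_nat s * x s) * y (q - s) + x s * (of_nat (q - s) * y (q - s)))"
    unfolding sum_distrib_left
  proof (rule sum.cong)
    fix s assume "s \<in> {..q}"
    then have "(of_nat q :: fock) = of_nat s + of_nat (q - s)" by (simp flip: of_nat_add)
    then show "of_nat q * (x s * y (q - s)) = (of_nat s * x s) * y (q - s) + x s * (of_nat (q - s) * y (q - s))"
      by (simp only: distrib_right distrib_left mult.assoc mult.left_commute)
  qed simp
  also have "\<dots> = (\<Sum>s\<le>q. \<Sum>n = 1..s. X n (s - n) * y (q - s)) + (\<Sum>s\<le>q. \<Sum>n = 1..q - s. x s * Y n (q - s - n))"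
    by (simp only: x y sum_distrib_left sum_distrib_right sum.distrib)
  also have "(\<Sum>s\<le>q. \<Sum>n = 1..s. X n (s - n) * y (q - s)) = (\<Sum>n = 1..q. \<Sum>s\<le>q - n. X n s * y (q - n - s))"
    unfolding sum.Sigma[OF finite_atMost ballI[OF finite_atLeastAtMost]] sum.Sigma[OF finite_atLeastAtMost ballI[OF finite_atMost]]
    by (rule sum.reindex_bij_witness[where i = "\<lambda>(n, s). (s + n, n)" and j = "\<lambda>(s, n). (n, s - n)"]) auto
  also have "(\<Sum>s\<le>q. \<Sum>n = 1..q - s. x s * Y n (q - s - n)) = (\<Sum>n = 1..q. \<Sum>s\<le>q - n. x s * Y n (q - n - s))"
    unfolding sum.Sigma[OF finite_atMost ballI[OF finite_atLeastAtMost]] sum.Sigma[OF finite_atLeastAtMost ballI[OF finite_atMost]]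
    by (rule sum.reindex_bij_witness[where i = "\<lambda>(n, s). (s, n)" and j = "\<lambda>(s, n). (n, s)"])
       (auto simp: add.commute)
  finally show ?thesis by (simp add: sum.distrib)
qed

section \<open>The creation series and the ring elements it produces\<close>

definition Hx :: "nat \<Rightarrow> cartan \<Rightarrow> nat \<Rightarrow> fock" where
  "Hx l \<xi> p = E_minus l \<xi> p 1"

lemma fock_eq_of_nat_mult: "k \<noteq> 0 \<Longrightarrow> of_nat k * v = of_nat k * (w :: fock) \<Longrightarrow> v = w"
  using scale_cancel[of "of_nat k" v w] by (simp add: scale_of_nat)

lemma E_minus_rec: "of_nat k * E_minus l \<xi> k v = (\<Sum>n = 1..k. hneg l \<xi> n * E_minus l \<xi> (k - n) v)"
proof -
  let ?A = "\<lambda>n v. scale (1 / of_nat n) (heis l \<xi> (- int n) v)"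
  have A: "?A n v = scale (1 / of_nat n) (hneg l \<xi> n * v)" for n v
    by (cases "n = 0") (auto simp: heis_neg)
  have "scale (of_nat k) (exp_coeff ?A k v) = (\<Sum>n = 1..k. scale (of_nat n) (?A n (exp_coeff ?A (k - n) v)))"
  proof (rule exp_coeff_rec)
    show "fock_linear (?A n)" for n
      unfolding A by (rule fock_linear_compose[OF fock_linear_scale fock_linear_mult])
    show "?A m (?A n v) = ?A n (?A m v)" for m n v
      unfolding A by (simp add: scale_mult_right mult.left_commute mult.commute)
  qed
  also have "\<dots> = (\<Sum>n = 1..k. hneg l \<xi> n * exp_coeff ?A (k - n) v)"
    by (rule sum.cong) (auto simp: A)
  finally show ?thesis by (simp add: E_minus_def scale_of_nat)
qed

lemma E_minus_0 [simp]: "E_minus l \<xi> 0 v = v" by (simp add: E_minus_def)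

text \<open>The recursion only multiplies by elements \<open>hneg\<close>, so in a commutative ring
  the operator is multiplication by its value on 1. For a simple root these values are the
  \<open>H_{i,n}\<close>.\<close>

lemma E_minus_eq: "E_minus l \<xi> p v = Hx l \<xi> p * v"
proof (induction p rule: less_induct)
  case (less p)
  show ?case
  proof (cases "p = 0")
    case False
    have "of_nat p * E_minus l \<xi> p v = (\<Sum>n = 1..p. hneg l \<xi> n * (Hx l \<xi> (p - n) * v))"
      unfolding E_minus_rec by (rule sum.cong) (auto simp: less)
    also have "\<dots> = of_nat p * (Hx l \<xi> p * v)"
      by (simp add: Hx_def mult.assoc[symmetric] E_minus_rec sum_distrib_right)
    finally show ?thesis by (rule fock_eq_of_nat_mult[OF False])
  qed (simp add: Hx_def)
qed

lemma Hx_0 [simp]: "Hx l \<xi> 0 = 1" by (simp add: Hx_def)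

lemma Hx_rec: "of_nat k * Hx l \<xi> k = (\<Sum>n = 1..k. hneg l \<xi> n * Hx l \<xi> (k - n))"
  by (simp add: Hx_def E_minus_rec)

lemma form_add_right: "form l x (y + z) = form l x y + form l x z"
  by (simp add: form_def distrib_left sum.distrib plus_fun_apply)

lemma form_sym: "form l x y = form l y x"
  by (simp add: form_def mult.commute)

lemma form_0 [simp]: "form l x 0 = 0" "form l 0 x = 0"
  by (simp_all add: form_def zero_fun_apply)

lemma hneg_add: "hneg l (\<xi> + \<eta>) n = hneg l \<xi> n + hneg l \<eta> n"
  by (simp add: hneg_def form_add_right fock.scale_left_distrib sum.distrib)

text \<open>The exponent is additive in the weight. For a general positive root this writes the
  series through those of simple roots.\<close>

lemma Hx_add: "Hx l (\<xi> + \<eta>) k = (\<Sum>s\<le>k. Hx l \<xi> s * Hx l \<eta> (k - s))"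
proof (induction k rule: less_induct)
  case (less k)
  show ?case
  proof (cases "k = 0")
    case False
    have "of_nat k * (\<Sum>s\<le>k. Hx l \<xi> s * Hx l \<eta> (k - s)) =
      (\<Sum>n = 1..k. \<Sum>s\<le>k - n. (hneg l \<xi> n * Hx l \<xi> s) * Hx l \<eta> (k - n - s) + Hx l \<xi> s * (hneg l \<eta> n * Hx l \<eta> (k - n - s)))"
      by (rule cauchy_product_rec) (rule Hx_rec)+
    also have "\<dots> = (\<Sum>n = 1..k. hneg l (\<xi> + \<eta>) n * (\<Sum>s\<le>k - n. Hx l \<xi> s * Hx l \<eta> (k - n - s)))"
      by (simp add: hneg_add sum_distrib_left sum.distrib algebra_simps)
    also have "\<dots> = of_nat k * Hx l (\<xi> + \<eta>) k"
      unfolding Hx_rec by (rule sum.cong) (auto simp: less)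
    finally show ?thesis by (rule fock_eq_of_nat_mult[OF False, symmetric])
  qed simp
qed

lemma Hx_zero: "Hx l 0 k = (if k = 0 then 1 else 0)"
proof (cases "k = 0")
  case False
  have "of_nat k * Hx l 0 k = of_nat k * 0" by (simp add: Hx_rec hneg_def)
  with False show ?thesis using fock_eq_of_nat_mult[OF False] by auto
qed simp

section \<open>The annihilation series as a multiplicative operator\<close>

lemma fock_linear_E_plus: "fock_linear (E_plus l \<xi> k)"
  and E_plus_rec: "of_nat k * E_plus l \<xi> k v = - (\<Sum>n = 1..k. hpos l \<xi> n (E_plus l \<xi> (k - n) v))"
proof -
  let ?A = "\<lambda>n v. scale (- 1 / of_nat n) (heis l \<xi> (int n) v)"
  have A: "?A n v = scale (- 1 / of_nat n) (hpos l \<xi> n v)" for n v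
    by (cases "n = 0") (auto simp: heis_pos)
  have lin: "fock_linear (?A n)" for n
    unfolding A by (rule fock_linear_compose[OF fock_linear_scale fock_linear_hpos])
  then show "fock_linear (E_plus l \<xi> k)"
    unfolding E_plus_def by (rule fock_linear_exp_coeff)
  have "scale (of_nat k) (exp_coeff ?A k v) = (\<Sum>n = 1..k. scale (of_nat n) (?A n (exp_coeff ?A (k - n) v)))"
  proof (rule exp_coeff_rec[OF lin])
    show "?A m (?A n v) = ?A n (?A m v)" for m n v
      unfolding A
      by (simp only: fock_pair.linear_scale[OF fock_linear_hpos] fock.scale_scale
          hpos_commute[of l \<xi> m] mult.commute)
  qed
  also have "\<dots> = (\<Sum>n = 1..k. - hpos l \<xi> n (exp_coeff ?A (k - n) v))"
    by (rule sum.cong) (auto simp: heis_pos)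
  finally show "of_nat k * E_plus l \<xi> k v = - (\<Sum>n = 1..k. hpos l \<xi> n (E_plus l \<xi> (k - n) v))"
    by (simp add: E_plus_def scale_of_nat sum_negf)
qed

lemma E_plus_0 [simp]: "E_plus l \<xi> 0 v = v" by (simp add: E_plus_def)

lemma hpos_of_nat_mult: "hpos l \<xi> n (of_nat k * v) = of_nat k * hpos l \<xi> n v"
  using fock_pair.linear_scale[OF fock_linear_hpos, of l \<xi> n "of_nat k" v] by (simp add: scale_of_nat)

lemma hpos_E_plus_commute: "hpos l \<eta> m (E_plus l \<xi> k v) = E_plus l \<xi> k (hpos l \<eta> m v)"
proof (induction k rule: less_induct)
  case (less k)
  show ?case
  proof (cases "k = 0")
    case False
    have "of_nat k * hpos l \<eta> m (E_plus l \<xi> k v) = - (\<Sum>n = 1..k. hpos l \<eta> m (hpos l \<xi> n (E_plus l \<xi> (k - n) v)))"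
      by (simp only: hpos_of_nat_mult[symmetric] E_plus_rec fock_pair.linear_neg[OF fock_linear_hpos]
         fock_pair.linear_sum[OF fock_linear_hpos])
    also have "\<dots> = of_nat k * E_plus l \<xi> k (hpos l \<eta> m v)"
      unfolding E_plus_rec by (rule arg_cong[where f = uminus], rule sum.cong) (auto simp: hpos_commute[of l \<eta>] less)
    finally show ?thesis by (rule fock_eq_of_nat_mult[OF False])
  qed simp
qed

lemma E_plus_commute: "E_plus l \<eta> m (E_plus l \<xi> k v) = E_plus l \<xi> k (E_plus l \<eta> m v)"
proof (induction k rule: less_induct)
  case (less k)
  show ?case
  proof (cases "k = 0")
    case False
    have "of_nat k * E_plus l \<eta> m (E_plus l \<xi> k v) = E_plus l \<eta> m (of_nat k * E_plus l \<xi> k v)"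
      using fock_pair.linear_scale[OF fock_linear_E_plus, of l \<eta> m "of_nat k"] by (simp add: scale_of_nat)
    also have "\<dots> = - (\<Sum>n = 1..k. E_plus l \<eta> m (hpos l \<xi> n (E_plus l \<xi> (k - n) v)))"
      by (simp only: E_plus_rec fock_pair.linear_neg[OF fock_linear_E_plus] fock_pair.linear_sum[OF fock_linear_E_plus])
    also have "\<dots> = of_nat k * E_plus l \<xi> k (E_plus l \<eta> m v)"
      unfolding E_plus_rec[of k]
      by (rule arg_cong[where f = uminus], rule sum.cong) (auto simp: hpos_E_plus_commute[symmetric] less)
    finally show ?thesis by (rule fock_eq_of_nat_mult[OF False])
  qed simp
qed

text \<open>The exponential of a derivation is an algebra homomorphism; on coefficients this is a
  Cauchy product, and both sides satisfy the same recursion.\<close>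

lemma E_plus_mult: "E_plus l \<xi> q (v * w) = (\<Sum>s\<le>q. E_plus l \<xi> s v * E_plus l \<xi> (q - s) w)"
proof (induction q rule: less_induct)
  case (less q)
  show ?case
  proof (cases "q = 0")
    case False
    have "of_nat q * (\<Sum>s\<le>q. E_plus l \<xi> s v * E_plus l \<xi> (q - s) w) =
      (\<Sum>n = 1..q. \<Sum>s\<le>q - n. (- hpos l \<xi> n (E_plus l \<xi> s v)) * E_plus l \<xi> (q - n - s) w
         + E_plus l \<xi> s v * (- hpos l \<xi> n (E_plus l \<xi> (q - n - s) w)))"
      by (rule cauchy_product_rec) (simp_all only: E_plus_rec sum_negf)
    also have "\<dots> = - (\<Sum>n = 1..q. hpos l \<xi> n (\<Sum>s\<le>q - n. E_plus l \<xi> s v * E_plus l \<xi> (q - n - s) w))"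
      by (simp add: fock_pair.linear_sum[OF fock_linear_hpos] hpos_mult sum_negf[symmetric] algebra_simps)
    also have "\<dots> = of_nat q * E_plus l \<xi> q (v * w)"
      unfolding E_plus_rec by (rule arg_cong[where f = uminus], rule sum.cong) (auto simp: less)
    finally show ?thesis by (rule fock_eq_of_nat_mult[OF False, symmetric])
  qed simp
qed

lemma E_plus_eq_0:
  assumes "\<And>n. n \<ge> 1 \<Longrightarrow> hpos l \<xi> n v = 0" "q \<ge> 1"
  shows "E_plus l \<xi> q v = 0"
  using \<open>q \<ge> 1\<close>
proof (induction q rule: less_induct)
  case (less q)
  have "hpos l \<xi> n (E_plus l \<xi> (q - n) v) = 0" if "n \<in> {1..q}" for n
    using less.IH[of "q - n"] that assms(1)[of n]
    by (cases "q - n = 0") (auto simp: fock_pair.linear_0[OF fock_linear_hpos])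
  then have "of_nat q * E_plus l \<xi> q v = of_nat q * 0"
    unfolding E_plus_rec by simp
  then show ?case by (rule fock_eq_of_nat_mult[rotated]) (use less.prems in simp)
qed

lemma E_plus_expo: "E_plus l \<xi> q (expo \<beta>) = (if q = 0 then expo \<beta> else 0)"
  by (auto intro!: E_plus_eq_0 simp: hpos_expo)

lemma E_plus_mult_expo: "E_plus l \<xi> q (v * expo \<beta>) = E_plus l \<xi> q v * expo \<beta>"
proof -
  have "E_plus l \<xi> q (v * expo \<beta>) = (\<Sum>s\<le>q. if s = q then E_plus l \<xi> q v * expo \<beta> else 0)"
    unfolding E_plus_mult by (rule sum.cong) (auto simp: E_plus_expo)
  then show ?thesis by simp
qed

lemma E_plus_one: "E_plus l \<xi> q 1 = (if q = 0 then 1 else 0)"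
  using E_plus_expo[of l \<xi> q 0] by (simp add: expo_0)

text \<open>Applied to \<open>H_i(z)\<close>, the derivation \<open>xi(n)\<close> differentiates the
  exponent and returns \<open><xi, alpha_i> z^n H_i(z)\<close>; the statement is the coefficient of
  \<open>z^p\<close>.\<close>

lemma hpos_Hx:
  assumes i: "i \<in> {1..l}" and n: "n \<ge> 1"
  shows "hpos l \<xi> n (Hx l (simple_root i) p)
    = (if n \<le> p then scale (form l \<xi> (simple_root i)) (Hx l (simple_root i) (p - n)) else 0)"
proof (induction p rule: less_induct)
  case (less p)
  let ?a = "hneg l (simple_root i)" and ?H = "Hx l (simple_root i)" and ?c = "form l \<xi> (simple_root i)"
  show ?case
  proof (cases "p = 0")
    case False
    have "of_nat p * hpos l \<xi> n (?H p) = (\<Sum>m = 1..p. hpos l \<xi> n (?a m * ?H (p - m)))"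
      unfolding hpos_of_nat_mult[symmetric] Hx_rec fock_pair.linear_sum[OF fock_linear_hpos] ..
    \<comment> \<open>The derivation hits either the generator, which leaves only
      \<open>m = n\<close>, or the remaining factor, where the induction hypothesis applies.\<close>
    also have "\<dots> = (\<Sum>m = 1..p. (if m = n then scale (of_nat n * ?c) (?H (p - n)) else 0)
          + (if m \<le> p - n \<and> n \<le> p then scale ?c (?a m * ?H (p - n - m)) else 0))"
    proof (rule sum.cong)
      fix m assume m: "m \<in> {1..p}"
      have "hpos l \<xi> n (?H (p - m)) = (if n \<le> p - m then scale ?c (?H (p - m - n)) else 0)"
        using m by (intro less) auto
      moreover have "n \<le> p - m \<longleftrightarrow> m \<le> p - n \<and> n \<le> p" using m n by auto
      ultimately show "hpos l \<xi> n (?a m * ?H (p - m)) = (if m = n then scale (of_nat n * ?c) (?H (p - n)) else 0)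
          + (if m \<le> p - n \<and> n \<le> p then scale ?c (?a m * ?H (p - n - m)) else 0)"
        using m n by (auto simp: hpos_mult hpos_hneg[OF i] scale_mult_left scale_mult_right diff_commute add.commute)
    qed simp
    also have "\<dots> = of_nat p * (if n \<le> p then scale ?c (?H (p - n)) else 0)"
    proof (cases "n \<le> p")
      case True
      have "(\<Sum>m = 1..p. if m \<le> p - n then scale ?c (?a m * ?H (p - n - m)) else 0)
          = (\<Sum>m = 1..p - n. scale ?c (?a m * ?H (p - n - m)))"
        by (rule sum.mono_neutral_cong_right) auto
      also have "\<dots> = scale ?c (of_nat (p - n) * ?H (p - n))"
        by (simp add: Hx_rec fock.scale_sum_right)
      finally have "(\<Sum>m = 1..p. (if m = n then scale (of_nat n * ?c) (?H (p - n)) else 0)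
          + (if m \<le> p - n \<and> n \<le> p then scale ?c (?a m * ?H (p - n - m)) else 0))
        = scale (of_nat n * ?c) (?H (p - n)) + scale ?c (of_nat (p - n) * ?H (p - n))"
        using True n by (simp add: sum.distrib)
      also have "\<dots> = scale ((of_nat n + of_nat (p - n)) * ?c) (?H (p - n))"
        by (simp only: fock.scale_left_distrib distrib_right scale_of_nat[symmetric] fock.scale_scale mult.commute[of ?c])
      also have "of_nat n + of_nat (p - n) = (of_nat p :: complex)"
        using True by (simp flip: of_nat_add)
      finally show ?thesis using True by (simp add: scale_of_nat[symmetric])
    qed auto
    finally show ?thesis by (rule fock_eq_of_nat_mult[OF False])
  qed (use n in \<open>simp add: hpos_expo flip: expo_0\<close>)
qed

text \<open>The coefficients of \<open>(1 - u)\<^sup>c\<close>: the series \<open>E\<^sup>+(-\<xi>, x)\<close> multiplies \<open>H\<^sub>i(z)\<close> by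
  \<open>(1 - z/x)\<^sup>c\<close> with \<open>c = \<langle>\<xi>, \<alpha>\<^sub>i\<rangle>\<close>.\<close>

definition bcoef :: "complex \<Rightarrow> nat \<Rightarrow> complex" where
  "bcoef c q = (- 1) ^ q * (c gchoose q)"

text \<open>Coefficientwise form of \<open>u f' = - c u f / (1 - u)\<close> for
  \<open>f = (1 - u)^c\<close>. It has the shape of \<open>E_plus_rec\<close>, which is what
  \<open>E_plus_Hx\<close> compares it with.\<close>

lemma bcoef_rec: "of_nat q * bcoef c q = - (c * (\<Sum>n = 1..q. bcoef c (q - n)))"
proof (induction q)
  case (Suc q)
  have rev: "(\<Sum>n = 1..q. bcoef c (q - n)) = (\<Sum>n<q. bcoef c n)" for q
    by (rule sum.reindex_bij_witness[where i = "\<lambda>n. q - n" and j = "\<lambda>n. q - n"]) auto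
  have "(\<Sum>n = 1..Suc q. bcoef c (Suc q - n)) = (\<Sum>n = 1..q. bcoef c (q - n)) + bcoef c q"
    unfolding rev by simp
  then have "c * (\<Sum>n = 1..Suc q. bcoef c (Suc q - n)) = - (of_nat q * bcoef c q) + c * bcoef c q"
    using Suc by (simp add: distrib_left)
  moreover have "of_nat (Suc q) * (c gchoose Suc q) = (c - of_nat q) * (c gchoose q)"
    using gbinomial_absorption[of q c] gbinomial_absorb_comp[of c q] by (simp add: mult.commute)
  moreover have "of_nat (Suc q) * bcoef c (Suc q) = - ((- 1) ^ q * (of_nat (Suc q) * (c gchoose Suc q)))"
    by (simp add: bcoef_def del: of_nat_Suc)
  ultimately show ?case
    by (simp only:) (simp add: bcoef_def algebra_simps)
qed simp

lemma E_plus_Hx: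
  assumes i: "i \<in> {1..l}"
  shows "E_plus l \<xi> q (Hx l (simple_root i) p)
    = (if q \<le> p then scale (bcoef (form l \<xi> (simple_root i)) q) (Hx l (simple_root i) (p - q)) else 0)"
proof (induction q rule: less_induct)
  case (less q)
  let ?H = "Hx l (simple_root i)" and ?c = "form l \<xi> (simple_root i)"
  show ?case
  proof (cases "q = 0")
    case False
    have "of_nat q * E_plus l \<xi> q (?H p) = - (\<Sum>n = 1..q. if q \<le> p then scale (bcoef ?c (q - n) * ?c) (?H (p - q)) else 0)"
      unfolding E_plus_rec
    proof (rule arg_cong[where f = uminus], rule sum.cong)
      fix n assume n: "n \<in> {1..q}"
      then show "hpos l \<xi> n (E_plus l \<xi> (q - n) (?H p)) = (if q \<le> p then scale (bcoef ?c (q - n) * ?c) (?H (p - q)) else 0)"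
        using less[of "q - n"]
        by (auto simp: fock_pair.linear_scale[OF fock_linear_hpos] fock_pair.linear_0[OF fock_linear_hpos] hpos_Hx[OF i])
    qed simp
    also have "\<dots> = (if q \<le> p then scale (- (?c * (\<Sum>n = 1..q. bcoef ?c (q - n)))) (?H (p - q)) else 0)"
      by (simp add: fock.scale_sum_left[symmetric] sum_distrib_left mult.commute)
    also have "\<dots> = of_nat q * (if q \<le> p then scale (bcoef ?c q) (?H (p - q)) else 0)"
      by (simp only: bcoef_rec[symmetric]) (simp add: scale_of_nat[symmetric])
    finally show ?thesis by (rule fock_eq_of_nat_mult[OF False])
  qed (simp add: bcoef_def)
qed

section \<open>Weights and products of complete symmetric functions\<close>

text \<open>Elements of the positive cone of the root lattice are recorded by multisets of simple
  root indices, so that an induction over the multiset adds one simple root at a time.\<close>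

definition root_sum :: "nat multiset \<Rightarrow> cartan" where
  "root_sum K = (\<Sum>i\<in>#K. simple_root i)"

lemma root_sum_empty [simp]: "root_sum {#} = 0" and root_sum_add_mset: "root_sum (add_mset i K) = root_sum K + simple_root i"
  and root_sum_union: "root_sum (K + L) = root_sum K + root_sum L"
  by (simp_all add: root_sum_def add.commute)

lemma form_fund_weight_root_sum:
  assumes "j \<in> {1..l}" "set_mset K \<subseteq> {1..l}"
  shows "form l (fund_weight l j) (root_sum K) = of_nat (count K j)"
  using assms(2)
proof (induction K)
  case (add i K)
  then show ?case using assms(1)
    by (simp add: root_sum_add_mset form_add_right form_fund_weight_simple_root)
qed simp

text \<open>Pairing with the fundamental weights recovers the multiplicities.\<close>

lemma root_sum_inj:
  assumes "root_sum K = root_sum L" "set_mset K \<subseteq> {1..l}" "set_mset L \<subseteq> {1..l}"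
  shows "K = L"
proof (rule multiset_eqI)
  fix j
  show "count K j = count L j"
  proof (cases "j \<in> {1..l}")
    case True
    then have "(of_nat (count K j) :: complex) = of_nat (count L j)"
      using form_fund_weight_root_sum[OF True assms(2)] form_fund_weight_root_sum[OF True assms(3)] assms(1) by simp
    then show ?thesis by simp
  next
    case False
    then show ?thesis using assms(2,3) by (metis count_eq_zero_iff subset_iff)
  qed
qed

lemma root_diff_eq_root_sum: "i < j \<Longrightarrow> root_diff i j = root_sum (mset [i..<j])"
proof (induction j)
  case (Suc j)
  show ?case
  proof (cases "i = j")
    case True
    then show ?thesis by (simp add: root_sum_def simple_root_def)
  next
    case False
    have "root_diff i (Suc j) = root_diff i j + simple_root j"
      by (auto simp: root_diff_def simple_root_def fun_eq_iff plus_fun_apply)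
    with False Suc show ?thesis by (simp add: root_sum_def add.commute)
  qed
qed simp

lemma pos_rootsE:
  assumes "\<alpha> \<in> pos_roots l"
  obtains A where "\<alpha> = root_sum A" "set_mset A \<subseteq> {1..l}"
proof -
  from assms obtain i j where "\<alpha> = root_diff i j" "1 \<le> i" "i < j" "j \<le> l + 1"
    by (auto simp: pos_roots_def)
  then show ?thesis by (intro that[of "mset [i..<j]"]) (auto simp: root_diff_eq_root_sum)
qed

lemma simple_root_pos_roots: "i \<in> {1..l} \<Longrightarrow> simple_root i \<in> pos_roots l"
  unfolding pos_roots_def simple_root_def by force

section \<open>Membership and integrality in the two lattices\<close>

lemma lattice_intro:
  fixes f :: "nat \<Rightarrow> cartan" and l :: nat
  defines "L \<equiv> {\<lambda>k. \<Sum>i = 1..l. of_int (m i) * f i k | m :: nat \<Rightarrow> int. True}"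
  shows "0 \<in> L" and "x \<in> L \<Longrightarrow> y \<in> L \<Longrightarrow> x + y \<in> L" and "x \<in> L \<Longrightarrow> - x \<in> L"
    and "i \<in> {1..l} \<Longrightarrow> f i \<in> L"
proof -
  show "0 \<in> L" unfolding L_def by (auto intro!: exI[of _ "\<lambda>_. 0"] simp: fun_eq_iff zero_fun_apply)
  show "x + y \<in> L" if "x \<in> L" "y \<in> L"
  proof -
    from that obtain m n where "x = (\<lambda>k. \<Sum>i = 1..l. of_int (m i) * f i k)" "y = (\<lambda>k. \<Sum>i = 1..l. of_int (n i) * f i k)"
      unfolding L_def by blast
    then show ?thesis unfolding L_def
      by (auto intro!: exI[of _ "\<lambda>i. m i + n i"] simp: fun_eq_iff distrib_right sum.distrib plus_fun_apply)
  qed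
  show "- x \<in> L" if "x \<in> L"
  proof -
    from that obtain m where "x = (\<lambda>k. \<Sum>i = 1..l. of_int (m i) * f i k)"
      unfolding L_def by blast
    then show ?thesis unfolding L_def
      by (auto intro!: exI[of _ "\<lambda>i. - m i"] simp: fun_eq_iff sum_negf)
  qed
  show "f i \<in> L" if "i \<in> {1..l}"
  proof -
    have "(\<Sum>k = 1..l. of_int (if k = i then 1 else 0) * f k x) = (\<Sum>k = 1..l. if k = i then f k x else 0)" for x
      by (rule sum.cong) auto
    with that show ?thesis unfolding L_def
      by (auto intro!: exI[of _ "\<lambda>k. if k = i then 1 else 0"] simp: fun_eq_iff)
  qed
qed

lemmas root_lattice_intro = lattice_intro[where f = simple_root, folded root_lattice_def]
lemmas weight_lattice_intro = lattice_intro[where f = "fund_weight l" and l = l for l, folded weight_lattice_def]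

lemma root_sum_root_lattice: "set_mset K \<subseteq> {1..l} \<Longrightarrow> root_sum K \<in> root_lattice l"
  by (induction K) (auto simp: root_sum_add_mset intro!: root_lattice_intro)

lemma fund_weight_0 [simp]: "fund_weight l 0 = 0"
  by (auto simp: fund_weight_def fun_eq_iff zero_fun_apply)

lemma fund_weight_weight_lattice: "j \<le> l \<Longrightarrow> fund_weight l j \<in> weight_lattice l"
  by (cases "j = 0") (auto intro!: weight_lattice_intro)

text \<open>Row \<open>i\<close> of the Cartan matrix gives
  \<open>alpha_i = 2 lambda_i - lambda_{i-1} - lambda_{i+1}\<close>; the boundary cases are covered
  because the formula for \<open>fund_weight\<close> yields 0 at the indices 0 and
  \<open>l + 1\<close>.\<close>

lemma simple_root_weight_lattice:
  assumes "i \<in> {1..l}"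
  shows "simple_root i \<in> weight_lattice l"
proof -
  have top: "fund_weight l (Suc l) = 0"
    by (auto simp: fund_weight_def fun_eq_iff zero_fun_apply simp flip: of_nat_Suc)
  have "simple_root i = fund_weight l i + fund_weight l i + (- fund_weight l (i - 1) + - fund_weight l (Suc i))"
  proof
    fix k
    have "of_nat i * 2 / (1 + of_nat l) = (of_nat i - 1) / (1 + of_nat l) + (1 + of_nat i) / (1 + of_nat l :: complex)"
      by (simp flip: add_divide_distrib)
    then show "simple_root i k = (fund_weight l i + fund_weight l i + (- fund_weight l (i - 1) + - fund_weight l (Suc i))) k"
      using assms by (auto simp: simple_root_def root_diff_def fund_weight_def field_simps plus_fun_apply)
  qed
  moreover have "fund_weight l (Suc i) \<in> weight_lattice l"
    using assms top weight_lattice_intro(1) by (cases "i = l") (auto intro!: fund_weight_weight_lattice)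
  moreover have "fund_weight l i \<in> weight_lattice l" "fund_weight l (i - 1) \<in> weight_lattice l"
    using assms by (auto intro!: fund_weight_weight_lattice)
  ultimately show ?thesis
    by (simp only: weight_lattice_intro(2,3))
qed

lemma root_sum_weight_lattice: "set_mset K \<subseteq> {1..l} \<Longrightarrow> root_sum K \<in> weight_lattice l"
  by (induction K) (auto simp: root_sum_add_mset intro!: weight_lattice_intro(1,2) simple_root_weight_lattice)

lemma root_sum_Ints: "root_sum K k \<in> \<int>"
  by (induction K) (auto simp: root_sum_add_mset simple_root_def root_diff_def plus_fun_apply zero_fun_apply)

lemma form_root_sum_Ints: "form l (root_sum A) (root_sum B) \<in> \<int>"
  unfolding form_def by (intro Ints_sum Ints_mult root_sum_Ints)

lemma form_root_sum_fund_weight_Ints: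
  assumes "j \<le> l" "set_mset A \<subseteq> {1..l}"
  shows "form l (root_sum A) (fund_weight l j) \<in> \<int>"
  using assms form_fund_weight_root_sum[of j l A] by (cases "j = 0") (auto simp: form_sym[of l "root_sum A"])

text \<open>The pair \<open>(i, n)\<close> stands for the factor \<open>H\<^sub>i\<^sub>,\<^sub>n\<close>.  Pairs \<open>(i, 0)\<close> do not change the product but
  count for the weight.\<close>

definition Hprod :: "nat \<Rightarrow> (nat \<times> nat) multiset \<Rightarrow> fock" where
  "Hprod l M = (\<Prod>x\<in>#M. Hx l (simple_root (fst x)) (snd x))"

abbreviation colours :: "(nat \<times> nat) multiset \<Rightarrow> nat multiset" where
  "colours M \<equiv> image_mset fst M"

abbreviation total :: "(nat \<times> nat) multiset \<Rightarrow> nat" where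
  "total M \<equiv> \<Sum>x\<in>#M. snd x"

lemma Hprod_empty [simp]: "Hprod l {#} = 1"
  and Hprod_add_mset: "Hprod l (add_mset (i, n) M) = Hx l (simple_root i) n * Hprod l M"
  and Hprod_union: "Hprod l (M + M') = Hprod l M * Hprod l M'"
  by (simp_all add: Hprod_def)

section \<open>Polynomial degree, leading monomials and linear independence\<close>

definition graded :: "nat \<Rightarrow> cartan \<Rightarrow> fock set" where
  "graded n \<beta> = {v. \<forall>b \<in> Poly_Mapping.keys v. snd b = \<beta> \<and> n \<le> size (fst b)}"

lemma subspace_keys: "fock.subspace {v. \<forall>b \<in> Poly_Mapping.keys v. P b}"
  by (rule fock.subspaceI) (auto simp: in_keys_iff lookup_add)

lemma subspace_graded: "fock.subspace (graded n \<beta>)"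
  unfolding graded_def by (rule subspace_keys)

lemma graded_mult:
  assumes "v \<in> graded n \<beta>" "w \<in> graded m \<gamma>"
  shows "v * w \<in> graded (n + m) (\<beta> + \<gamma>)"
proof -
  have "Poly_Mapping.keys (v * w) \<subseteq> {a + b | a b. a \<in> Poly_Mapping.keys v \<and> b \<in> Poly_Mapping.keys w}"
    by (rule keys_mult)
  with assms show ?thesis unfolding graded_def by (fastforce simp: size_union)
qed

lemma basis_vec_graded: "n \<le> size \<mu> \<Longrightarrow> basis_vec \<mu> \<beta> \<in> graded n \<beta>"
  by (simp add: basis_vec_def graded_def)

lemma one_graded: "1 \<in> graded 0 0"
  using basis_vec_graded[of 0 "{#}" 0] by (simp add: basis_vec_one)

lemma expo_graded: "expo \<beta> \<in> graded 0 \<beta>"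
  using basis_vec_graded[of 0 "{#}" \<beta>] by (simp add: expo_def)

lemma graded_mono: "v \<in> graded n \<beta> \<Longrightarrow> m \<le> n \<Longrightarrow> v \<in> graded m \<beta>"
  by (auto simp: graded_def)

text \<open>Lowest terms in the number of generators are tracked because they are multiplicative and
  each \<open>H_{i,n}\<close> has a single one.\<close>

definition leading :: "fock \<Rightarrow> (nat \<times> nat) multiset \<Rightarrow> cartan \<Rightarrow> bool" where
  "leading v \<mu> \<beta> \<longleftrightarrow> (\<exists>c w. c \<noteq> 0 \<and> w \<in> graded (Suc (size \<mu>)) \<beta> \<and> v = scale c (basis_vec \<mu> \<beta>) + w)"

lemma leading_graded: "leading v \<mu> \<beta> \<Longrightarrow> v \<in> graded (size \<mu>) \<beta>"
  unfolding leading_def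
  by (auto intro!: fock.subspace_add fock.subspace_scale subspace_graded basis_vec_graded
      elim: graded_mono)

lemma leading_mult:
  assumes "leading v \<mu> \<beta>" "leading w \<nu> \<gamma>"
  shows "leading (v * w) (\<mu> + \<nu>) (\<beta> + \<gamma>)"
proof -
  from assms obtain c v' d w' where c: "c \<noteq> 0" "d \<noteq> 0"
    and v': "v' \<in> graded (Suc (size \<mu>)) \<beta>" "v = scale c (basis_vec \<mu> \<beta>) + v'"
    and w': "w' \<in> graded (Suc (size \<nu>)) \<gamma>" "w = scale d (basis_vec \<nu> \<gamma>) + w'"
    unfolding leading_def by blast
  have "v * w = scale (c * d) (basis_vec (\<mu> + \<nu>) (\<beta> + \<gamma>)) + (scale c (basis_vec \<mu> \<beta> * w') + v' * w)"
    unfolding v'(2) by (simp add: w'(2) distrib_left distrib_right scale_mult_left scale_mult_right basis_vec_mult fock.scale_right_distrib)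
  moreover have "basis_vec \<mu> \<beta> * w' \<in> graded (Suc (size (\<mu> + \<nu>))) (\<beta> + \<gamma>)"
    using graded_mult[OF basis_vec_graded[OF order_refl] w'(1)] by simp
  moreover have "v' * w \<in> graded (Suc (size (\<mu> + \<nu>))) (\<beta> + \<gamma>)"
    using graded_mult[OF v'(1) leading_graded[OF assms(2)]] by simp
  ultimately show ?thesis using c unfolding leading_def
    by (intro exI[of _ "c * d"] exI[of _ "scale c (basis_vec \<mu> \<beta> * w') + v' * w"])
       (auto intro!: fock.subspace_add fock.subspace_scale subspace_graded)
qed

lemma leading_expo: "leading (expo \<beta>) {#} \<beta>"
  unfolding leading_def expo_def
  by (rule exI[of _ 1], rule exI[of _ 0]) (auto simp: fock.subspace_0[OF subspace_graded])

text \<open>In \<open>n H_{i,n} = alpha_i(-n) + sum alpha_i(-m) H_{i,n-m}\<close> over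
  \<open>0 < m < n\<close>, every summand after the first has at least two generators, since the
  factor \<open>H_{i,n-m}\<close> has at least one by induction. Index 0 contributes the empty
  monomial.\<close>

lemma leading_Hx:
  assumes i: "i \<in> {1..l}"
  shows "leading (Hx l (simple_root i) n) (if n = 0 then {#} else {#(i, n)#}) 0"
proof (induction n rule: less_induct)
  case (less n)
  let ?H = "Hx l (simple_root i)"
  show ?case
  proof (cases "n = 0")
    case True
    then show ?thesis using leading_expo[of 0] by (simp add: expo_0)
  next
    case False
    have "of_nat n * ?H n = gen (i, n) + (\<Sum>m = 1..n - 1. gen (i, m) * ?H (n - m))"
      using False unfolding Hx_rec hneg_simple_root[OF i] by (cases n) auto
    then have "scale (1 / of_nat n) (scale (of_nat n) (?H n))
       = scale (1 / of_nat n) (gen (i, n)) + scale (1 / of_nat n) (\<Sum>m = 1..n - 1. gen (i, m) * ?H (n - m))"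
      by (simp only: scale_of_nat fock.scale_right_distrib)
    then have "?H n = scale (1 / of_nat n) (gen (i, n)) + scale (1 / of_nat n) (\<Sum>m = 1..n - 1. gen (i, m) * ?H (n - m))"
      using False by simp
    moreover have "gen (i, m) * ?H (n - m) \<in> graded 2 0" if "m \<in> {1..n - 1}" for m
    proof -
      have "n - m \<noteq> 0" "n - m < n" using that by auto
      then have "?H (n - m) \<in> graded 1 0"
        using leading_graded[OF less[of "n - m"]] by simp
      from graded_mult[OF basis_vec_graded[of 1 "{#(i, m)#}" 0] this] show ?thesis
        by (simp add: gen_def numeral_2_eq_2)
    qed
    ultimately show ?thesis using False unfolding leading_def gen_def
      by (intro exI[of _ "1 / of_nat n"] exI[of _ "scale (1 / of_nat n) (\<Sum>m = 1..n - 1. gen (i, m) * ?H (n - m))"])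
         (auto simp: gen_def numeral_2_eq_2 intro!: fock.subspace_scale fock.subspace_sum subspace_graded)
  qed
qed

abbreviation pos_part :: "(nat \<times> nat) multiset \<Rightarrow> (nat \<times> nat) multiset" where
  "pos_part M \<equiv> filter_mset (\<lambda>x. snd x \<noteq> 0) M"

lemma leading_Hprod:
  assumes "set_mset (colours M) \<subseteq> {1..l}"
  shows "leading (Hprod l M) (pos_part M) 0"
  using assms
proof (induction M)
  case empty
  then show ?case using leading_expo[of 0] by (simp add: expo_0)
next
  case (add x M)
  obtain i n where x: "x = (i, n)" by force
  from add.prems have "i \<in> {1..l}" by (simp add: x)
  from leading_mult[OF leading_Hx[OF this, of n] add.IH] add.prems show ?case
    by (auto simp: x Hprod_add_mset)
qed

lemma Hprod_graded: "set_mset (colours M) \<subseteq> {1..l} \<Longrightarrow> Hprod l M \<in> graded 0 0"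
  using leading_graded[OF leading_Hprod] graded_mono by blast

text \<open>The leading monomial of a product sees only factors of positive index; the colours tell
  how many factors of index 0 are missing.\<close>

lemma colours_pos_part_inj:
  assumes "colours M = colours M'" "pos_part M = pos_part M'"
  shows "M = M'"
proof -
  have *: "M = pos_part M + image_mset (\<lambda>i. (i, 0)) (colours M - colours (pos_part M))" for M :: "(nat \<times> nat) multiset"
  proof -
    have M: "M = pos_part M + filter_mset (\<lambda>x. snd x = 0) M"
      using multiset_partition[of M "\<lambda>x. snd x \<noteq> 0"] by simp
    have "colours M - colours (pos_part M) = colours (filter_mset (\<lambda>x. snd x = 0) M)"
      by (subst (1) M) (simp only: image_mset_union add_diff_cancel_left')
    moreover have "image_mset (\<lambda>i. (i, 0)) (colours (filter_mset (\<lambda>x. snd x = 0) M)) = filter_mset (\<lambda>x. snd x = 0) M"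
      unfolding multiset.map_comp by (rule trans[OF image_mset_cong multiset.map_ident]) auto
    ultimately show ?thesis using M by simp
  qed
  show ?thesis by (subst *[of M], subst *[of M']) (simp only: assms)
qed

text \<open>Among the terms with nonzero coefficient, one whose leading monomial has fewest
  generators is isolated: this monomial, taken together with its weight, occurs in no other
  term.\<close>

lemma Hprod_independent:
  assumes "finite F" and F: "\<And>M. M \<in> F \<Longrightarrow> set_mset (colours M) \<subseteq> {1..l}"
    and sum0: "(\<Sum>M\<in>F. scale (a M) (Hprod l M * expo (root_sum (colours M) + \<delta>))) = 0"
    and "M \<in> F"
  shows "a M = 0"
proof (rule ccontr)
  assume "a M \<noteq> 0"
  define F' where "F' = {M \<in> F. a M \<noteq> 0}"
  have "M \<in> F'" using \<open>M \<in> F\<close> \<open>a M \<noteq> 0\<close> by (simp add: F'_def)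
  then obtain M0 where M0: "M0 \<in> F'" and min: "\<And>M. M \<in> F' \<Longrightarrow> size (pos_part M0) \<le> size (pos_part M)"
    using arg_min_natI[of "\<lambda>M. M \<in> F'" M "\<lambda>M. size (pos_part M)"]
      arg_min_nat_le[of "\<lambda>M. M \<in> F'" _ "\<lambda>M. size (pos_part M)"] by blast
  let ?v = "\<lambda>M. Hprod l M * expo (root_sum (colours M) + \<delta>)"
  let ?b = "(pos_part M0, root_sum (colours M0) + \<delta>)"
  have lead: "leading (?v M) (pos_part M) (root_sum (colours M) + \<delta>)" if "M \<in> F" for M
    using leading_mult[OF leading_Hprod[OF F[OF that]] leading_expo] by simp
  have other: "Poly_Mapping.lookup (?v M) ?b = 0" if M: "M \<in> F'" "M \<noteq> M0" for M
  proof (rule ccontr)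
    from M M0 have "M \<in> F" "M0 \<in> F" by (auto simp: F'_def)
    assume nz: "Poly_Mapping.lookup (?v M) ?b \<noteq> 0"
    from lead[OF \<open>M \<in> F\<close>] obtain c w where
      w: "w \<in> graded (Suc (size (pos_part M))) (root_sum (colours M) + \<delta>)"
      and v: "?v M = scale c (basis_vec (pos_part M) (root_sum (colours M) + \<delta>)) + w"
      unfolding leading_def by blast
    \<comment> \<open>Minimality of \<open>M0\<close> makes the monomials in the tail of
      \<open>?v M\<close> too long, so only the leading term could meet \<open>?b\<close>.\<close>
    have "\<not> ?b \<in> Poly_Mapping.keys w" using w min[OF M(1)] unfolding graded_def by fastforce
    with nz have eq: "pos_part M = pos_part M0" "root_sum (colours M) = root_sum (colours M0)"
      by (auto simp: v lookup_add in_keys_iff basis_vec_def lookup_single when_def split: if_splits)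
    have "M = M0"
      by (rule colours_pos_part_inj[OF _ eq(1)]) (rule root_sum_inj[OF eq(2) F[OF \<open>M \<in> F\<close>] F[OF \<open>M0 \<in> F\<close>]])
    with M show False by simp
  qed
  have "M0 \<in> F" using M0 by (simp add: F'_def)
  from lead[OF this] obtain c w where "c \<noteq> 0" and
      w: "w \<in> graded (Suc (size (pos_part M0))) (root_sum (colours M0) + \<delta>)"
      and v: "?v M0 = scale c (basis_vec (pos_part M0) (root_sum (colours M0) + \<delta>)) + w"
      unfolding leading_def by blast
  have "\<not> ?b \<in> Poly_Mapping.keys w" using w unfolding graded_def by fastforce
  then have nz: "Poly_Mapping.lookup (?v M0) ?b \<noteq> 0"
    using \<open>c \<noteq> 0\<close> by (simp add: v lookup_add in_keys_iff basis_vec_def)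
  have "0 = Poly_Mapping.lookup (\<Sum>M\<in>F. scale (a M) (?v M)) ?b" by (simp add: sum0)
  also have "\<dots> = (\<Sum>M\<in>F. a M * Poly_Mapping.lookup (?v M) ?b)" by (simp add: lookup_sum)
  also have "\<dots> = (\<Sum>M\<in>{M0}. a M * Poly_Mapping.lookup (?v M) ?b)"
    by (rule sum.mono_neutral_right) (use \<open>finite F\<close> \<open>M0 \<in> F\<close> other in \<open>auto simp: F'_def\<close>)
  finally show False using nz M0 by (simp add: F'_def)
qed

section \<open>Products of given colours with bounded total index\<close>

definition Hspan :: "nat \<Rightarrow> nat multiset \<Rightarrow> nat \<Rightarrow> fock set" where
  "Hspan l K d = fock.span {Hprod l M | M. colours M = K \<and> total M < d}"

lemma subspace_Hspan: "fock.subspace (Hspan l K d)"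
  by (simp add: Hspan_def)

lemma Hprod_Hspan: "colours M = K \<Longrightarrow> total M < d \<Longrightarrow> Hprod l M \<in> Hspan l K d"
  unfolding Hspan_def by (rule fock.span_base) blast

lemma Hspan_mono: "d \<le> d' \<Longrightarrow> Hspan l K d \<subseteq> Hspan l K d'"
  unfolding Hspan_def by (rule fock.span_mono) auto

text \<open>The bound on \<open>total\<close> is strict so that \<open>d = 0\<close> gives the zero
  space: inductions on \<open>d\<close> then start trivially, and with truncated subtraction
  \<open>Hspan l K (d - q)\<close> expresses vanishing once \<open>q\<close> reaches
  \<open>d\<close>.\<close>

lemma Hspan_0: "Hspan l K 0 = {0}"
  by (simp add: Hspan_def)

lemma Hspan_induct:
  assumes "u \<in> Hspan l K d" "fock.subspace {u. P u}" "\<And>M. colours M = K \<Longrightarrow> total M < d \<Longrightarrow> P (Hprod l M)"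
  shows "P u"
proof -
  have "Hspan l K d \<subseteq> {u. P u}" unfolding Hspan_def by (rule fock.span_minimal) (use assms in auto)
  with assms(1) show ?thesis by blast
qed

lemma subspace_linear_vimage: "fock_linear f \<Longrightarrow> fock.subspace S \<Longrightarrow> fock.subspace {v. f v \<in> S}"
  using fock_pair.linear_subspace_vimage[of f S] by (simp add: vimage_def)

lemma Hspan_mult_Hprod:
  assumes "u \<in> Hspan l K d"
  shows "Hprod l M * u \<in> Hspan l (colours M + K) (total M + d)"
  using assms
proof (rule Hspan_induct)
  show "fock.subspace {u. Hprod l M * u \<in> Hspan l (colours M + K) (total M + d)}"
    by (rule subspace_linear_vimage[OF fock_linear_mult subspace_Hspan])
  fix M' assume "colours M' = K" "total M' < d"
  then show "Hprod l M * Hprod l M' \<in> Hspan l (colours M + K) (total M + d)"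
    unfolding Hprod_union[symmetric] by (intro Hprod_Hspan) auto
qed

lemma Hx_mult_Hspan: "u \<in> Hspan l K d \<Longrightarrow> Hx l (simple_root i) n * u \<in> Hspan l (add_mset i K) (n + d)"
  using Hspan_mult_Hprod[of u l K d "{#(i, n)#}"] by (simp add: Hprod_def)

lemma E_plus_Hprod:
  assumes "set_mset (colours M) \<subseteq> {1..l}" "total M < d"
  shows "E_plus l \<xi> q (Hprod l M) \<in> Hspan l (colours M) (d - q)"
  using assms
proof (induction M arbitrary: q d)
  case empty
  then show ?case
    using Hprod_Hspan[of "{#}" "{#}" d l] by (auto simp: E_plus_one fock.subspace_0[OF subspace_Hspan])
next
  case (add x M)
  obtain i n where x: "x = (i, n)" by force
  have i: "i \<in> {1..l}" and tot: "total M < d - n" using add.prems by (auto simp: x)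
  have "E_plus l \<xi> s (Hx l (simple_root i) n) * E_plus l \<xi> (q - s) (Hprod l M) \<in> Hspan l (colours (add_mset x M)) (d - q)"
    if "s \<le> q" for s
  proof (cases "s \<le> n")
    case True
    have "Hx l (simple_root i) (n - s) * E_plus l \<xi> (q - s) (Hprod l M) \<in> Hspan l (add_mset i (colours M)) (n - s + (d - n - (q - s)))"
      using add.prems by (intro Hx_mult_Hspan add.IH tot) auto
    \<comment> \<open>If truncation occurs in \<open>d - n - (q - s)\<close>, the numerical bound
      may fail, but then the factor lies in \<open>Hspan\<close> at 0 and is zero.\<close>
    moreover have "E_plus l \<xi> (q - s) (Hprod l M) = 0 \<or> n - s + (d - n - (q - s)) \<le> d - q"
    proof (cases "q - s \<le> d - n")
      case False
      then have "d - n - (q - s) = 0" by simp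
      with add.IH[of "d - n" "q - s"] add.prems tot show ?thesis by (simp add: Hspan_0)
    qed (use True that tot in auto)
    ultimately have "Hx l (simple_root i) (n - s) * E_plus l \<xi> (q - s) (Hprod l M) \<in> Hspan l (add_mset i (colours M)) (d - q)"
      using Hspan_mono[of "n - s + (d - n - (q - s))" "d - q"] by (auto simp: fock.subspace_0[OF subspace_Hspan])
    then show ?thesis using True
      by (simp add: x E_plus_Hx[OF i] scale_mult_left fock.subspace_scale[OF subspace_Hspan])
  next
    case False
    then show ?thesis by (simp add: E_plus_Hx[OF i] fock.subspace_0[OF subspace_Hspan])
  qed
  then show ?case
    by (auto simp: x Hprod_add_mset E_plus_mult intro!: fock.subspace_sum[OF subspace_Hspan])
qed

lemma E_plus_Hspan:
  assumes "set_mset K \<subseteq> {1..l}" "u \<in> Hspan l K d"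
  shows "E_plus l \<xi> q u \<in> Hspan l K (d - q)"
  using assms(2)
proof (rule Hspan_induct)
  show "fock.subspace {u. E_plus l \<xi> q u \<in> Hspan l K (d - q)}"
    by (rule subspace_linear_vimage[OF fock_linear_E_plus subspace_Hspan])
  show "E_plus l \<xi> q (Hprod l M) \<in> Hspan l K (d - q)" if "colours M = K" "total M < d" for M
    using E_plus_Hprod[of M l d \<xi> q] that assms(1) by simp
qed

text \<open>By \<open>Hx_add\<close> the series of a sum of simple roots is a product with one
  factor for each of them. This keeps the root vectors of non-simple roots within the spans of
  products.\<close>

lemma Hx_root_sum_Hspan: "Hx l (root_sum A) p \<in> Hspan l A (Suc p)"
proof (induction A arbitrary: p)
  case empty
  show ?case using Hprod_Hspan[of "{#}" "{#}" "Suc p" l] by (auto simp: Hx_zero fock.subspace_0[OF subspace_Hspan])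
next
  case (add i A)
  have "Hx l (root_sum A) s * Hx l (simple_root i) (p - s) \<in> Hspan l (add_mset i A) (Suc p)" if "s \<le> p" for s
    using Hx_mult_Hspan[OF add.IH[of s], of i "p - s"] that by (simp add: mult.commute)
  then show ?case
    by (auto simp: root_sum_add_mset Hx_add intro!: fock.subspace_sum[OF subspace_Hspan])
qed

lemma Hspan_mult:
  assumes "u \<in> Hspan l K d" "v \<in> Hspan l L e"
  shows "u * v \<in> Hspan l (K + L) (d + e)"
  using assms(1)
proof (rule Hspan_induct)
  show "fock.subspace {u. u * v \<in> Hspan l (K + L) (d + e)}"
    by (rule subspace_linear_vimage[OF fock_linear_mult' subspace_Hspan])
  show "Hprod l M * v \<in> Hspan l (K + L) (d + e)" if "colours M = K" "total M < d" for M
    using Hspan_mult_Hprod[OF assms(2), of M] Hspan_mono[of "total M + e" "d + e"] that by auto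
qed

lemma Hspan_graded: "set_mset K \<subseteq> {1..l} \<Longrightarrow> u \<in> Hspan l K d \<Longrightarrow> u \<in> graded 0 0"
  by (erule Hspan_induct) (use Hprod_graded[of _ l] in \<open>auto simp: subspace_graded simp del: set_image_mset\<close>)

section \<open>Explicit coefficients of lattice vertex operators\<close>

definition Hz :: "nat \<Rightarrow> cartan \<Rightarrow> int \<Rightarrow> fock" where
  "Hz l \<xi> t = (if t < 0 then 0 else Hx l \<xi> (nat t))"

text \<open>One annihilation operator turns a generator into a scalar and the next kills it, so only
  the linear term of the exponential contributes, and it vanishes at modes other than
  \<open>n\<close>.\<close>

lemma E_plus_gen: "q > n \<Longrightarrow> E_plus l \<xi> q (gen (i, n)) = 0"
proof -
  have hp: "hpos l \<xi> m (gen (i, n)) \<in> range (\<lambda>c. scale c 1)" for m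
    unfolding hpos_def partial_deriv_gen by (auto intro!: fock.subspace_sum fock.subspace_scale
       simp: fock.span_singleton[symmetric] fock.span_zero fock.span_base fock.span_scale)
  have h1: "hpos l \<xi> m v = 0" if "v \<in> range (\<lambda>c. scale c 1)" for m v
    using that hpos_expo[of l \<xi> m 0] by (auto simp: expo_0 fock_pair.linear_scale[OF fock_linear_hpos])
  have "E_plus l \<xi> q (gen (i, n)) \<in> range (\<lambda>c. scale c 1) \<and> of_nat q * E_plus l \<xi> q (gen (i, n)) = - hpos l \<xi> q (gen (i, n))"
    if "q \<ge> 1" for q
    using that
  proof (induction q rule: less_induct)
    case (less q)
    have "of_nat q * E_plus l \<xi> q (gen (i, n)) = - (\<Sum>m = 1..q. if m = q then hpos l \<xi> q (gen (i, n)) else 0)"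
      unfolding E_plus_rec
      by (rule arg_cong[where f = uminus], rule sum.cong) (use less.IH h1 in auto)
    then have eq: "of_nat q * E_plus l \<xi> q (gen (i, n)) = - hpos l \<xi> q (gen (i, n))"
      using less.prems by simp
    obtain c where "hpos l \<xi> q (gen (i, n)) = scale c 1" using hp by auto
    with eq have "of_nat q * E_plus l \<xi> q (gen (i, n)) = of_nat q * scale (- c / of_nat q) 1"
      using less.prems by (simp add: scale_of_nat[symmetric])
    then have "E_plus l \<xi> q (gen (i, n)) = scale (- c / of_nat q) 1"
      by (rule fock_eq_of_nat_mult[rotated]) (use less.prems in simp)
    with eq show ?case by blast
  qed
  note * = this
  assume "q > n"
  then have "hpos l \<xi> q (gen (i, n)) = 0" by (simp add: hpos_def partial_deriv_gen)
  with *[of q] \<open>q > n\<close> have "of_nat q * E_plus l \<xi> q (gen (i, n)) = of_nat q * 0" by simp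
  then show ?thesis by (rule fock_eq_of_nat_mult[rotated]) (use \<open>q > n\<close> in simp)
qed

text \<open>\<open>vop_exp\<close> is defined monomial by monomial, so the finiteness of its sum has
  to be known for arbitrary monomials and not just for products of the
  \<open>H_{i,n}\<close>.\<close>

lemma E_plus_basis_vec: "q > total \<mu> \<Longrightarrow> E_plus l \<xi> q (basis_vec \<mu> \<beta>) = 0"
proof (induction \<mu> arbitrary: q)
  case empty
  then show ?case using E_plus_expo[of l \<xi> q \<beta>] by (simp add: expo_def)
next
  case (add x \<mu>)
  obtain i n where x: "x = (i, n)" by force
  have "basis_vec (add_mset x \<mu>) \<beta> = gen (i, n) * basis_vec \<mu> \<beta>"
    by (simp add: gen_def basis_vec_mult x)
  moreover have "E_plus l \<xi> s (gen (i, n)) * E_plus l \<xi> (q - s) (basis_vec \<mu> \<beta>) = 0" if "s \<le> q" for s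
  proof (cases "s > n")
    case True
    then show ?thesis by (simp add: E_plus_gen)
  next
    case False
    then have "q - s > total \<mu>" using add.prems by (simp add: x)
    then show ?thesis by (simp add: add.IH)
  qed
  ultimately show ?case by (simp add: E_plus_mult)
qed

text \<open>The exponent condition forces \<open>p = t + q\<close>, which collapses the double sum;
  \<open>Hz\<close>, being 0 at negative arguments, absorbs the requirement that \<open>p\<close> is
  a natural number. The free upper limit \<open>N\<close> lets several vectors share one
  bound.\<close>

lemma vop_exp_basis_vec:
  assumes t: "r - form l \<xi> \<beta> = of_int t" and N: "total \<mu> \<le> N"
  shows "vop_exp l \<epsilon> \<xi> r (basis_vec \<mu> \<beta>)
    = scale (\<epsilon> \<xi> \<beta>) ((\<Sum>q\<le>N. Hz l \<xi> (t + int q) * E_plus l \<xi> q (basis_vec \<mu> \<beta>)) * expo \<xi>)"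
proof -
  let ?g = "\<lambda>(p, q). if of_nat p - of_nat q + form l \<xi> \<beta> = r
     then scale (\<epsilon> \<xi> \<beta>) (E_minus l \<xi> p (E_plus l \<xi> q (basis_vec \<mu> (\<xi> + \<beta>)))) else 0"
  have cond: "of_nat p - of_nat q + form l \<xi> \<beta> = r \<longleftrightarrow> int p = t + int q" for p q
  proof -
    have "of_nat p - of_nat q + form l \<xi> \<beta> = r \<longleftrightarrow> (of_int (int p) :: complex) = of_int (t + int q)"
      using t by (auto simp: algebra_simps)
    then show ?thesis by (simp only: of_int_eq_iff)
  qed
  have bv: "basis_vec \<mu> (\<xi> + \<beta>) = basis_vec \<mu> \<beta> * expo \<xi>"
    by (simp add: expo_def basis_vec_mult add.commute)
  have "vop_exp l \<epsilon> \<xi> r (basis_vec \<mu> \<beta>) = Sum_any ?g"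
    by (simp add: vop_exp_def)
  also have "\<dots> = sum ?g ((\<lambda>q. (nat (t + int q), q)) ` {..N})"
  proof (rule Sum_any.expand_superset)
    show "{a. ?g a \<noteq> 0} \<subseteq> (\<lambda>q. (nat (t + int q), q)) ` {..N}"
    proof (intro subsetI, elim CollectE)
      fix a assume "?g a \<noteq> 0"
      then obtain p q where a: "a = (p, q)" and nz: "?g (p, q) \<noteq> 0" by (cases a) auto
      from nz have "int p = t + int q" unfolding cond by (auto split: if_splits)
      moreover have "q \<le> N"
      proof (rule ccontr)
        assume "\<not> q \<le> N"
        then have "E_plus l \<xi> q (basis_vec \<mu> (\<xi> + \<beta>)) = 0" using N by (intro E_plus_basis_vec) simp
        with nz show False by (simp add: E_minus_eq split: if_splits)
      qed
      ultimately show "a \<in> (\<lambda>q. (nat (t + int q), q)) ` {..N}"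
        by (intro image_eqI[of _ _ q]) (auto simp: a)
    qed
  qed simp
  also have "\<dots> = (\<Sum>q\<le>N. ?g (nat (t + int q), q))"
    by (subst sum.reindex) (auto simp: inj_on_def)
  also have "\<dots> = (\<Sum>q\<le>N. scale (\<epsilon> \<xi> \<beta>) (Hz l \<xi> (t + int q) * E_plus l \<xi> q (basis_vec \<mu> \<beta>) * expo \<xi>))"
    by (rule sum.cong) (auto simp: cond Hz_def E_minus_eq bv E_plus_mult_expo mult.assoc)
  also have "\<dots> = scale (\<epsilon> \<xi> \<beta>) ((\<Sum>q\<le>N. Hz l \<xi> (t + int q) * E_plus l \<xi> q (basis_vec \<mu> \<beta>)) * expo \<xi>)"
    by (simp add: fock.scale_sum_right sum_distrib_right)
  finally show ?thesis .
qed

lemma fock_linear_vop_exp: "fock_linear (vop_exp l \<epsilon> \<xi> r)"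
  unfolding vop_exp_def by (rule fock_linear_lin_ext)

text \<open>The required bound depends on the monomials of \<open>v\<close>. Phrased with
  \<open>eventually\<close>, finitely many such statements combine without naming a bound.\<close>

lemma vop_exp_eq:
  assumes v: "v \<in> graded 0 \<beta>" and t: "r - form l \<xi> \<beta> = of_int t"
  shows "\<forall>\<^sub>F N in sequentially. vop_exp l \<epsilon> \<xi> r v
    = scale (\<epsilon> \<xi> \<beta>) ((\<Sum>q\<le>N. Hz l \<xi> (t + int q) * E_plus l \<xi> q v) * expo \<xi>)"
proof -
  let ?T = "\<lambda>N v. scale (\<epsilon> \<xi> \<beta>) ((\<Sum>q\<le>N. Hz l \<xi> (t + int q) * E_plus l \<xi> q v) * expo \<xi>)"
  have T: "fock_linear (?T N)" for N
    by (intro fock_linear_compose[OF fock_linear_scale] fock_linear_compose[OF fock_linear_mult']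
       fock_linear_sum fock_linear_compose[OF fock_linear_mult fock_linear_E_plus])
  have "\<forall>b\<in>Poly_Mapping.keys v. \<forall>\<^sub>F N in sequentially. vop_exp l \<epsilon> \<xi> r (basis_vec (fst b) (snd b)) = ?T N (basis_vec (fst b) (snd b))"
  proof
    fix b assume "b \<in> Poly_Mapping.keys v"
    then have "snd b = \<beta>" using v by (auto simp: graded_def)
    then show "\<forall>\<^sub>F N in sequentially. vop_exp l \<epsilon> \<xi> r (basis_vec (fst b) (snd b)) = ?T N (basis_vec (fst b) (snd b))"
      using vop_exp_basis_vec[OF t, of "fst b" _ \<epsilon>] by (auto simp: eventually_sequentially)
  qed
  then have "\<forall>\<^sub>F N in sequentially. \<forall>b\<in>Poly_Mapping.keys v. vop_exp l \<epsilon> \<xi> r (basis_vec (fst b) (snd b)) = ?T N (basis_vec (fst b) (snd b))"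
    by (intro eventually_ball_finite) auto
  then show ?thesis
  proof eventually_elim
    case (elim N)
    have "vop_exp l \<epsilon> \<xi> r v = (\<Sum>b\<in>Poly_Mapping.keys v. scale (Poly_Mapping.lookup v b) (vop_exp l \<epsilon> \<xi> r (basis_vec (fst b) (snd b))))"
      by (subst (1) fock_expansion[of v])
         (simp add: fock_pair.linear_sum[OF fock_linear_vop_exp] fock_pair.linear_scale[OF fock_linear_vop_exp])
    also have "\<dots> = (\<Sum>b\<in>Poly_Mapping.keys v. scale (Poly_Mapping.lookup v b) (?T N (basis_vec (fst b) (snd b))))"
      by (rule sum.cong) (use elim in auto)
    also have "\<dots> = ?T N v"
      by (rule sym, rule trans[OF arg_cong[where f = "?T N", OF fock_expansion]])
         (simp only: fock_pair.linear_sum[OF T] fock_pair.linear_scale[OF T])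
    finally show ?case .
  qed
qed

section \<open>Principal subspaces\<close>

lemma fock_linear_root_op: "fock_linear (root_op l \<epsilon> \<alpha> m)"
  unfolding root_op_def by (rule fock_linear_vop_exp)

lemma root_op_eq:
  assumes u: "u \<in> graded 0 0" and b: "form l \<alpha> \<beta> = of_int b"
  shows "\<forall>\<^sub>F N in sequentially. root_op l \<epsilon> \<alpha> m (u * expo \<beta>)
    = scale (\<epsilon> \<alpha> \<beta>) ((\<Sum>q\<le>N. Hz l \<alpha> (- m - 1 - b + int q) * E_plus l \<alpha> q u) * expo (\<beta> + \<alpha>))"
proof -
  have "u * expo \<beta> \<in> graded 0 \<beta>" using graded_mult[OF u expo_graded[of \<beta>]] by simp
  moreover have "of_int (- m - 1) - form l \<alpha> \<beta> = of_int (- m - 1 - b)" by (simp add: b)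
  ultimately have "\<forall>\<^sub>F N in sequentially. root_op l \<epsilon> \<alpha> m (u * expo \<beta>)
    = scale (\<epsilon> \<alpha> \<beta>) ((\<Sum>q\<le>N. Hz l \<alpha> (- m - 1 - b + int q) * E_plus l \<alpha> q (u * expo \<beta>)) * expo \<alpha>)"
    unfolding root_op_def by (rule vop_exp_eq)
  then show ?thesis
    by eventually_elim (simp add: E_plus_mult_expo sum_distrib_right mult.assoc expo_mult)
qed

definition W_vec :: "nat \<Rightarrow> nat \<Rightarrow> (nat \<times> nat) multiset \<Rightarrow> fock" where
  "W_vec l j M = Hprod l M * expo (root_sum (colours M) + fund_weight l j)"

definition W_span :: "nat \<Rightarrow> nat \<Rightarrow> fock set" where
  "W_span l j = fock.span (W_vec l j ` {M. set_mset (colours M) \<subseteq> {1..l}})"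

lemma subspace_W_span: "fock.subspace (W_span l j)"
  by (simp add: W_span_def)

lemma W_vec_W_span: "set_mset (colours M) \<subseteq> {1..l} \<Longrightarrow> W_vec l j M \<in> W_span l j"
  unfolding W_span_def by (rule fock.span_base) blast

lemma W_span_induct:
  assumes "v \<in> W_span l j" "fock.subspace {v. P v}" "\<And>M. set_mset (colours M) \<subseteq> {1..l} \<Longrightarrow> P (W_vec l j M)"
  shows "P v"
proof -
  have "W_span l j \<subseteq> {v. P v}" unfolding W_span_def by (rule fock.span_minimal) (use assms in auto)
  with assms(1) show ?thesis by blast
qed

lemma Hspan_W_span:
  assumes "set_mset K \<subseteq> {1..l}" "u \<in> Hspan l K d"
  shows "u * expo (root_sum K + fund_weight l j) \<in> W_span l j"
  using assms(2)
proof (rule Hspan_induct)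
  show "fock.subspace {u. u * expo (root_sum K + fund_weight l j) \<in> W_span l j}"
    by (rule subspace_linear_vimage[OF fock_linear_mult' subspace_W_span])
  show "Hprod l M * expo (root_sum K + fund_weight l j) \<in> W_span l j" if "colours M = K" for M
    using W_vec_W_span[of M l j] that assms(1) by (simp add: W_vec_def)
qed

lemma form_root_sum_weight_Ints:
  assumes "j \<le> l" "set_mset A \<subseteq> {1..l}"
  obtains b where "form l (root_sum A) (root_sum K + fund_weight l j) = of_int b"
proof -
  have "form l (root_sum A) (root_sum K + fund_weight l j) \<in> \<int>"
    unfolding form_add_right by (intro Ints_add form_root_sum_Ints form_root_sum_fund_weight_Ints assms)
  then show ?thesis using that by (auto elim: Ints_cases)
qed

text \<open>Multiplication by the creation series adds one factor for each simple root in
  \<open>A\<close>, and the annihilation series keeps the colours of \<open>u\<close>, so the result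
  is again of product form at the new weight.\<close>

lemma root_op_W_vec:
  assumes "j \<le> l" "set_mset A \<subseteq> {1..l}" "set_mset K \<subseteq> {1..l}" "u \<in> Hspan l K d"
  shows "root_op l \<epsilon> (root_sum A) m (u * expo (root_sum K + fund_weight l j)) \<in> W_span l j"
proof -
  obtain b where b: "form l (root_sum A) (root_sum K + fund_weight l j) = of_int b"
    using form_root_sum_weight_Ints[OF assms(1,2)] .
  define t where "t = - m - 1 - b"
  obtain N where N: "root_op l \<epsilon> (root_sum A) m (u * expo (root_sum K + fund_weight l j))
    = scale (\<epsilon> (root_sum A) (root_sum K + fund_weight l j)) ((\<Sum>q\<le>N. Hz l (root_sum A) (t + int q) * E_plus l (root_sum A) q u)
        * expo (root_sum K + fund_weight l j + root_sum A))"
    using eventually_happens[OF root_op_eq[OF Hspan_graded[OF assms(3,4)] b]] unfolding t_def by auto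
  have "Hz l (root_sum A) (t + int q) * E_plus l (root_sum A) q u * expo (root_sum (A + K) + fund_weight l j) \<in> W_span l j" for q
  proof (cases "t + int q < 0")
    case True
    then show ?thesis by (simp add: Hz_def fock.subspace_0[OF subspace_W_span])
  next
    case False
    then have "Hz l (root_sum A) (t + int q) = Hx l (root_sum A) (nat (t + int q))" by (simp add: Hz_def)
    then show ?thesis
      using Hspan_W_span[OF _ Hspan_mult[OF Hx_root_sum_Hspan E_plus_Hspan[OF assms(3,4)]]] assms(2,3) by simp
  qed
  moreover have "root_sum (A + K) + fund_weight l j = root_sum K + fund_weight l j + root_sum A"
    by (simp add: root_sum_union ac_simps)
  ultimately show ?thesis unfolding N sum_distrib_right
    by (auto intro!: fock.subspace_scale fock.subspace_sum subspace_W_span)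
qed

lemma root_op_W_span:
  assumes "j \<le> l" "\<alpha> \<in> pos_roots l" "v \<in> W_span l j"
  shows "root_op l \<epsilon> \<alpha> m v \<in> W_span l j"
  using assms(3)
proof (rule W_span_induct)
  show "fock.subspace {v. root_op l \<epsilon> \<alpha> m v \<in> W_span l j}"
    by (rule subspace_linear_vimage[OF fock_linear_root_op subspace_W_span])
  fix M assume M: "set_mset (colours M) \<subseteq> {1..l}"
  obtain A where A: "\<alpha> = root_sum A" "set_mset A \<subseteq> {1..l}" using pos_rootsE[OF assms(2)] .
  show "root_op l \<epsilon> \<alpha> m (W_vec l j M) \<in> W_span l j"
    unfolding W_vec_def A(1) by (rule root_op_W_vec[OF assms(1) A(2) M Hprod_Hspan[OF refl lessI]])
qed

lemma hw_vec_eq: "hw_vec l j = W_vec l j {#}"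
  by (simp add: hw_vec_def W_vec_def expo_def)

lemma principal_subspace_subset:
  assumes "j \<le> l"
  shows "principal_subspace l \<epsilon> j \<subseteq> W_span l j"
  unfolding principal_subspace_def
proof (rule fock.span_minimal[OF _ subspace_W_span], clarify)
  fix xs :: "(cartan \<times> int) list"
  assume "fst ` set xs \<subseteq> pos_roots l"
  then show "foldr (\<lambda>(\<alpha>, m). root_op l \<epsilon> \<alpha> m) xs (hw_vec l j) \<in> W_span l j"
    by (induction xs) (auto simp: hw_vec_eq intro!: W_vec_W_span root_op_W_span[OF assms])
qed

text \<open>The top term of \<open>x\<^bsub>\<alpha>\<^sub>i\<^esub>(m)\<close> is multiplication by a complete symmetric function; the
  remaining terms lower the degree of \<open>u\<close>.\<close>

lemma Hz_mult_mem:
  assumes P: "fock.subspace P" and K: "set_mset K \<subseteq> {1..l}" and b: "form l (simple_root i) \<beta> = of_int b"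
    and nz: "\<epsilon> (simple_root i) \<beta> \<noteq> 0"
    and op: "\<And>u d m. u \<in> Hspan l K d \<Longrightarrow> root_op l \<epsilon> (simple_root i) m (u * expo \<beta>) \<in> P"
    and "u \<in> Hspan l K d"
  shows "Hz l (simple_root i) r * u * expo (\<beta> + simple_root i) \<in> P"
  using \<open>u \<in> Hspan l K d\<close>
proof (induction d arbitrary: u r)
  case 0
  then show ?case by (simp add: Hspan_0 fock.subspace_0[OF P])
next
  case (Suc d)
  let ?e = "expo (\<beta> + simple_root i)" and ?T = "\<lambda>q. Hz l (simple_root i) (r + int q) * E_plus l (simple_root i) q u"
  \<comment> \<open>The mode \<open>- r - 1 - b\<close> is the one whose term \<open>q = 0\<close>
    carries index exactly \<open>r\<close>.\<close>
  obtain N where N: "root_op l \<epsilon> (simple_root i) (- r - 1 - b) (u * expo \<beta>)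
    = scale (\<epsilon> (simple_root i) \<beta>) ((\<Sum>q\<le>N. ?T q) * ?e)"
    using eventually_happens[OF root_op_eq[OF Hspan_graded[OF K Suc.prems] b, of \<epsilon> "- r - 1 - b"]] by auto
  have "scale (1 / \<epsilon> (simple_root i) \<beta>) (root_op l \<epsilon> (simple_root i) (- r - 1 - b) (u * expo \<beta>)) \<in> P"
    by (intro fock.subspace_scale[OF P] op[OF Suc.prems])
  then have "(\<Sum>q\<le>N. ?T q) * ?e \<in> P" using nz by (simp add: N)
  \<comment> \<open>For \<open>q \<ge> 1\<close> the annihilation part lies in the span with bound
    \<open>d\<close>, so the induction hypothesis applies with \<open>r + q\<close> in place of
    \<open>r\<close>.\<close>
  moreover have "?T q * ?e \<in> P" if "q \<in> {1..N}" for q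
  proof (rule Suc.IH)
    have "Hspan l K (Suc d - q) \<subseteq> Hspan l K d" by (rule Hspan_mono) (use that in auto)
    then show "E_plus l (simple_root i) q u \<in> Hspan l K d" using E_plus_Hspan[OF K Suc.prems] by blast
  qed
  then have "(\<Sum>q=1..N. ?T q * ?e) \<in> P" by (rule fock.subspace_sum[OF P])
  moreover have "{..N} = insert 0 {1..N}" by auto
  then have "(\<Sum>q\<le>N. ?T q) * ?e = Hz l (simple_root i) r * u * ?e + (\<Sum>q=1..N. ?T q * ?e)"
    by (simp add: sum_distrib_right distrib_right)
  ultimately show ?case using fock.subspace_diff[OF P] by fastforce
qed

text \<open>One factor of colour \<open>i\<close> is split off and produced by modes of the simple
  root vector. The subspace \<open>P\<close> is arbitrary because two are needed: a principal
  subspace, and the set where an intertwining operator agrees with a given linear map.\<close>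

lemma Hprod_mem:
  assumes "fock.subspace P" "set_mset K \<subseteq> {1..l}" "form l (simple_root i) \<beta> = of_int b"
    and "\<epsilon> (simple_root i) \<beta> \<noteq> 0"
    and "\<And>u d m. u \<in> Hspan l K d \<Longrightarrow> root_op l \<epsilon> (simple_root i) m (u * expo \<beta>) \<in> P"
    and "u \<in> Hspan l (add_mset i K) d"
  shows "u * expo (\<beta> + simple_root i) \<in> P"
  using assms(6)
proof (rule Hspan_induct)
  show "fock.subspace {u. u * expo (\<beta> + simple_root i) \<in> P}"
    by (rule subspace_linear_vimage[OF fock_linear_mult' assms(1)])
  fix M assume "colours M = add_mset i K"
  then obtain x M' where "M = add_mset x M'" "fst x = i" "colours M' = K"
    by (metis msed_map_invR)
  then obtain n where M: "M = add_mset (i, n) M'" "colours M' = K" by (cases x) auto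
  have "Hz l (simple_root i) (int n) * Hprod l M' * expo (\<beta> + simple_root i) \<in> P"
    by (rule Hz_mult_mem[where \<epsilon> = \<epsilon>, OF assms(1-4)], rule assms(5), assumption, rule Hprod_Hspan[OF M(2) lessI])
  then show "Hprod l M * expo (\<beta> + simple_root i) \<in> P"
    by (simp add: M(1) Hprod_add_mset Hz_def)
qed

lemma cocycle_nonzero:
  assumes "lattice_cocycle l N \<epsilon>" "\<xi> \<in> weight_lattice l" "\<mu> \<in> weight_lattice l"
  shows "\<epsilon> \<xi> \<mu> \<noteq> 0"
proof
  assume "\<epsilon> \<xi> \<mu> = 0"
  moreover have "\<epsilon> \<xi> \<mu> ^ N = 1" "N \<ge> 1" using assms by (auto simp: lattice_cocycle_def)
  ultimately show False by (auto simp: power_0_left)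
qed

lemma weight_mem: "set_mset K \<subseteq> {1..l} \<Longrightarrow> j \<le> l \<Longrightarrow> root_sum K + fund_weight l j \<in> weight_lattice l"
  by (intro weight_lattice_intro root_sum_weight_lattice fund_weight_weight_lattice)

lemma root_sum_single: "root_sum {#i#} = simple_root i"
  by (simp add: root_sum_def)

lemma form_simple_root_weight:
  assumes "j \<le> l" "i \<in> {1..l}"
  obtains b where "form l (simple_root i) (root_sum K + fund_weight l j) = of_int b"
  using form_root_sum_weight_Ints[of j l "{#i#}" K] assms by (auto simp: root_sum_single)

text \<open>Induction on the colours, one simple root at a time; at each weight the claim covers
  every \<open>Hspan l K d\<close>, since \<open>Hprod_mem\<close> uses it in that
  generality.\<close>

lemma W_span_subset:
  assumes "j \<le> l" "lattice_cocycle l N \<epsilon>"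
  shows "W_span l j \<subseteq> principal_subspace l \<epsilon> j"
proof -
  let ?P = "principal_subspace l \<epsilon> j"
  have P: "fock.subspace ?P" by (simp add: principal_subspace_def)
  have closed: "root_op l \<epsilon> \<alpha> m v \<in> ?P" if "\<alpha> \<in> pos_roots l" "v \<in> ?P" for \<alpha> m v
  proof -
    have "?P \<subseteq> {v. root_op l \<epsilon> \<alpha> m v \<in> ?P}"
      unfolding principal_subspace_def
    proof (rule fock.span_minimal, clarify)
      fix xs :: "(cartan \<times> int) list" assume "fst ` set xs \<subseteq> pos_roots l"
      then show "root_op l \<epsilon> \<alpha> m (foldr (\<lambda>(\<alpha>, m). root_op l \<epsilon> \<alpha> m) xs (hw_vec l j))
        \<in> fock.span {foldr (\<lambda>(\<alpha>, m). root_op l \<epsilon> \<alpha> m) xs (hw_vec l j) | xs. fst ` set xs \<subseteq> pos_roots l}"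
        using that(1) by (intro fock.span_base CollectI exI[of _ "(\<alpha>, m) # xs"]) auto
    qed (intro subspace_linear_vimage fock_linear_root_op fock.subspace_span)
    with that show ?thesis by blast
  qed
  have "u * expo (root_sum K + fund_weight l j) \<in> ?P" if "set_mset K \<subseteq> {1..l}" "u \<in> Hspan l K d" for K u d
    using that
  proof (induction K arbitrary: u d)
    case empty
    have "hw_vec l j \<in> ?P" unfolding principal_subspace_def
      by (intro fock.span_base CollectI exI[of _ "[]"]) auto
    then have hw: "expo (fund_weight l j) \<in> ?P" by (simp add: hw_vec_def expo_def)
    show ?case using empty(2)
      by (rule Hspan_induct) (use hw subspace_linear_vimage[OF fock_linear_mult' P] in auto)
  next
    case (add i K)
    then have K: "set_mset K \<subseteq> {1..l}" and i: "i \<in> {1..l}" by auto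
    obtain b where b: "form l (simple_root i) (root_sum K + fund_weight l j) = of_int b"
      using form_simple_root_weight[OF assms(1) i] .
    have "u * expo (root_sum K + fund_weight l j + simple_root i) \<in> ?P"
    proof (rule Hprod_mem[OF P K b _ _ add.prems(2)])
      show "\<epsilon> (simple_root i) (root_sum K + fund_weight l j) \<noteq> 0"
        using assms i K by (intro cocycle_nonzero[OF assms(2)] simple_root_weight_lattice weight_mem)
      show "root_op l \<epsilon> (simple_root i) m (u * expo (root_sum K + fund_weight l j)) \<in> ?P" if "u \<in> Hspan l K d" for u d m
        by (intro closed simple_root_pos_roots i add.IH[OF K that])
    qed
    then show ?case by (simp add: root_sum_add_mset ac_simps)
  qed
  note * = this
  show ?thesis
    unfolding W_span_def
  proof (rule fock.span_minimal[OF _ P], clarify)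
    fix M assume "set_mset (colours M) \<subseteq> {1..l}"
    from *[OF this Hprod_Hspan[OF refl lessI]] show "W_vec l j M \<in> ?P"
      by (simp add: W_vec_def)
  qed
qed

lemma principal_subspace_eq:
  "j \<le> l \<Longrightarrow> lattice_cocycle l N \<epsilon> \<Longrightarrow> principal_subspace l \<epsilon> j = W_span l j"
  using principal_subspace_subset W_span_subset by (metis subset_antisym)

section \<open>The series of a fundamental weight and the index shift\<close>

lemma bcoef_of_bool: "bcoef (of_bool b) q = (if q = 0 then 1 else if q = 1 \<and> b then -1 else 0)"
  using binomial_gbinomial[of 1 q, where 'a = complex, symmetric]
  by (cases q; cases "q = 1"; cases b) (auto simp: bcoef_def gbinomial_0 binomial_eq_0)

text \<open>Here \<open>c = <lambda_j, alpha_i>\<close> is 0 or 1, so \<open>(1 - u)^c\<close> is 1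
  or \<open>1 - u\<close>, and the Cauchy product has at most the terms \<open>s = 0\<close> and
  \<open>s = 1\<close>.\<close>

lemma E_plus_fund_weight_Hz:
  assumes "j \<in> {1..l}" "i \<in> {1..l}"
  shows "E_plus l (fund_weight l j) q (Hz l (simple_root i) t * u)
    = Hz l (simple_root i) t * E_plus l (fund_weight l j) q u
     - (if i = j \<and> q \<noteq> 0 then Hz l (simple_root i) (t - 1) * E_plus l (fund_weight l j) (q - 1) u else 0)"
proof -
  let ?E = "E_plus l (fund_weight l j)" and ?H = "Hz l (simple_root i)"
  have E: "?E s (?H t) = (if s = 0 then ?H t else if s = 1 \<and> i = j then - ?H (t - 1) else 0)" for s
    using form_fund_weight_simple_root[OF assms]
    by (auto simp: Hz_def E_plus_Hx[OF assms(2)] bcoef_of_bool bcoef_of_bool[of True, simplified]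
        bcoef_of_bool[of False, simplified] E_plus_one fock_pair.linear_0[OF fock_linear_E_plus] nat_diff_distrib)
  show ?thesis
  proof (cases q)
    case (Suc q')
    have "?E q (?H t * u) = (\<Sum>s\<in>{0, 1}. ?E s (?H t) * ?E (q - s) u)"
      unfolding E_plus_mult by (rule sum.mono_neutral_right) (auto simp: E Suc)
    then show ?thesis by (auto simp: E Suc)
  qed simp
qed

text \<open>Each factor of colour \<open>j\<close> contributes one linear factor in
  \<open>1/x\<close> and other colours none, so the series is a polynomial of degree at most
  \<open>count K j\<close>.\<close>

lemma E_plus_fund_weight_eq_0:
  assumes "j \<in> {1..l}" "set_mset K \<subseteq> {1..l}" "u \<in> Hspan l K d" "q > count K j"
  shows "E_plus l (fund_weight l j) q u = 0"
  using assms(3)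
proof (rule Hspan_induct)
  show "fock.subspace {u. E_plus l (fund_weight l j) q u = 0}"
    using subspace_linear_vimage[OF fock_linear_E_plus fock.subspace_single_0] by simp
  have "q > count (colours M) j \<Longrightarrow> set_mset (colours M) \<subseteq> {1..l} \<Longrightarrow> E_plus l (fund_weight l j) q (Hprod l M) = 0" for M
  proof (induction M arbitrary: q)
    case empty
    then show ?case by (simp add: E_plus_one)
  next
    case (add x M)
    obtain i n where x: "x = (i, n)" by force
    have "Hprod l (add_mset x M) = Hz l (simple_root i) (int n) * Hprod l M"
      by (simp add: x Hprod_add_mset Hz_def)
    then show ?case using add.prems add.IH[of q] add.IH[of "q - 1"]
      by (auto simp: x E_plus_fund_weight_Hz[OF assms(1)] split: if_splits)
  qed
  then show "E_plus l (fund_weight l j) q (Hprod l M) = 0" if "colours M = K" for M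
    using that assms(2,4) by blast
qed

text \<open>On a product with \<open>k\<close> factors of colour \<open>j\<close>, the series \<open>E\<^sup>+(-\<lambda>\<^sub>j, x)\<close> acts as
  \<open>\<Prod>s. (1 - S\<^sub>s x\<^sup>-\<^sup>1)\<close>, where \<open>S\<^sub>s\<close> lowers the index of the \<open>s\<close>-th such factor; \<open>Dop\<close> extracts \<open>S\<^sub>1 \<cdots> S\<^sub>k\<close>.\<close>

definition Dop :: "nat \<Rightarrow> nat \<Rightarrow> nat multiset \<Rightarrow> fock \<Rightarrow> fock" where
  "Dop l j K u = scale ((- 1) ^ count K j) (E_plus l (fund_weight l j) (count K j) u)"

lemma fock_linear_Dop: "fock_linear (Dop l j K)"
  unfolding Dop_def by (rule fock_linear_compose[OF fock_linear_scale fock_linear_E_plus])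

text \<open>For \<open>i = j\<close> the next coefficient is taken; its unshifted part is beyond the
  degree of the series on \<open>u\<close> and vanishes, and the sign in \<open>Dop\<close> absorbs
  the sign of the shifted part.\<close>

lemma Dop_Hz:
  assumes "j \<in> {1..l}" "i \<in> {1..l}" "set_mset K \<subseteq> {1..l}" "u \<in> Hspan l K d"
  shows "Dop l j (add_mset i K) (Hz l (simple_root i) t * u) = Hz l (simple_root i) (t - of_bool (i = j)) * Dop l j K u"
  using E_plus_fund_weight_eq_0[OF assms(1,3,4)]
  by (auto simp: Dop_def E_plus_fund_weight_Hz[OF assms(1,2)] scale_mult_right)

text \<open>Truncated subtraction leaves \<open>(j, 0)\<close> fixed. This is harmless: a product
  with such a factor is annihilated by \<open>Dop\<close>, and \<open>shift\<close> is inverted only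
  away from it.\<close>

definition shift :: "nat \<Rightarrow> nat \<times> nat \<Rightarrow> nat \<times> nat" where
  "shift j x = (if fst x = j then (j, snd x - 1) else x)"

definition unshift :: "nat \<Rightarrow> nat \<times> nat \<Rightarrow> nat \<times> nat" where
  "unshift j x = (if fst x = j then (j, snd x + 1) else x)"

lemma fst_shift [simp]: "fst (shift j x) = fst x" and fst_unshift [simp]: "fst (unshift j x) = fst x"
  by (auto simp: shift_def unshift_def)

lemma colours_shift [simp]: "colours (image_mset (shift j) M) = colours M"
  and colours_unshift [simp]: "colours (image_mset (unshift j) M) = colours M"
  by (simp_all add: multiset.map_comp comp_def)

lemma shift_unshift: "image_mset (shift j) (image_mset (unshift j) M) = M"
  by (induction M) (auto simp: shift_def unshift_def)

lemma unshift_shift: "(j, 0) \<notin># M \<Longrightarrow> image_mset (unshift j) (image_mset (shift j) M) = M"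
  by (induction M) (auto simp: shift_def unshift_def)

lemma not_mem_unshift: "(j, 0) \<notin># image_mset (unshift j) M"
  by (auto simp: unshift_def split: if_splits)

lemma Dop_Hprod:
  assumes "j \<in> {1..l}" "set_mset (colours M) \<subseteq> {1..l}"
  shows "Dop l j (colours M) (Hprod l M) = (if (j, 0) \<in># M then 0 else Hprod l (image_mset (shift j) M))"
  using assms(2)
proof (induction M)
  case empty
  show ?case by (simp add: Dop_def)
next
  case (add x M)
  obtain i n where x: "x = (i, n)" by force
  have "Hprod l (add_mset x M) = Hz l (simple_root i) (int n) * Hprod l M"
    by (simp add: x Hprod_add_mset Hz_def)
  moreover have "Dop l j (colours (add_mset x M)) (Hz l (simple_root i) (int n) * Hprod l M)
     = Hz l (simple_root i) (int n - of_bool (i = j)) * Dop l j (colours M) (Hprod l M)"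
    using Dop_Hz[OF assms(1) _ _ Hprod_Hspan[OF refl lessI], of i M] add.prems by (simp add: x)
  moreover have "nat (int n - 1) = n - 1" by simp
  ultimately show ?case using add
    by (auto simp: x shift_def Hprod_add_mset Hz_def)
qed

section \<open>Exactness for a weightwise multiple of the shift\<close>

lemma span_image_sum:
  assumes "v \<in> fock.span (g ` I)"
  shows "\<exists>F a. finite F \<and> F \<subseteq> I \<and> v = (\<Sum>i\<in>F. scale (a i) (g i))"
  using assms
proof (induction rule: fock.span_induct_alt)
  case base
  show ?case by (rule exI[of _ "{}"]) simp
next
  case (step c x y)
  then obtain i F a where i: "i \<in> I" "x = g i" and F: "finite F" "F \<subseteq> I" "y = (\<Sum>i\<in>F. scale (a i) (g i))" by blast
  \<comment> \<open>The index \<open>i\<close> may already lie in \<open>F\<close>, in which case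
    the coefficients are added.\<close>
  let ?a = "\<lambda>k. (if k = i then c else 0) + (if k \<in> F then a k else 0)"
  have "(\<Sum>k\<in>insert i F. scale (?a k) (g k)) = (\<Sum>k\<in>insert i F. if k = i then scale c (g k) else 0)
      + (\<Sum>k\<in>insert i F. if k \<in> F then scale (a k) (g k) else 0)"
    unfolding sum.distrib[symmetric] by (rule sum.cong) (auto simp: fock.scale_left_distrib)
  also have "(\<Sum>k\<in>insert i F. if k \<in> F then scale (a k) (g k) else 0) = y"
    unfolding F(3) by (rule sum.mono_neutral_cong_right) (use F in auto)
  finally show ?case using i F
    by (intro exI[of _ "insert i F"] exI[of _ ?a]) auto
qed

text \<open>The argument common to both forms of the second map. Linearity of \<open>f\<close> is
  asked for only on \<open>W_span l 0\<close>, because the axioms of an intertwining operator say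
  nothing outside the modules; \<open>c\<close> collects the scalars that depend on the
  weight.\<close>

lemma short_exact_W_span:
  assumes j: "j \<in> {1..l}"
    and add: "\<And>v w. v \<in> W_span l 0 \<Longrightarrow> w \<in> W_span l 0 \<Longrightarrow> f (v + w) = f v + f w"
    and scale: "\<And>c v. v \<in> W_span l 0 \<Longrightarrow> f (scale c v) = scale c (f v)"
    and f: "\<And>M. set_mset (colours M) \<subseteq> {1..l} \<Longrightarrow> f (W_vec l 0 M)
      = scale (c (colours M)) (Dop l j (colours M) (Hprod l M) * expo (root_sum (colours M) + fund_weight l j))"
    and c: "\<And>K. set_mset K \<subseteq> {1..l} \<Longrightarrow> c K \<noteq> 0"
  shows "short_exact (W_span l j) (exp_mult (simple_root j - fund_weight l j)) (W_span l 0) f (W_span l j)"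
proof -
  let ?ok = "\<lambda>M. set_mset (colours M) \<subseteq> {1..l}" and ?e = "exp_mult (simple_root j - fund_weight l j)"
  have f': "f (W_vec l 0 M) = (if (j, 0) \<in># M then 0 else scale (c (colours M)) (W_vec l j (image_mset (shift j) M)))"
    if "?ok M" for M
    using f[OF that] Dop_Hprod[OF j that] by (auto simp: W_vec_def)
  have f0: "f 0 = 0" using scale[of 0 0] fock.subspace_0[OF subspace_W_span] by auto
  have fsum: "f (\<Sum>M\<in>F. scale (a M) (W_vec l 0 M)) = (\<Sum>M\<in>F. scale (a M) (f (W_vec l 0 M)))"
    if "finite F" "\<And>M. M \<in> F \<Longrightarrow> ?ok M" for F a
    using that
  proof (induction F)
    case (insert M F)
    have "(\<Sum>M\<in>F. scale (a M) (W_vec l 0 M)) \<in> W_span l 0"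
      using insert.prems by (intro fock.subspace_sum[OF subspace_W_span] fock.subspace_scale[OF subspace_W_span] W_vec_W_span) auto
    moreover have "W_vec l 0 M \<in> W_span l 0" using insert.prems by (intro W_vec_W_span) auto
    ultimately show ?case using insert by (simp add: add scale fock.subspace_scale[OF subspace_W_span])
  qed (simp add: f0)
  have into: "f v \<in> W_span l j" if "v \<in> W_span l 0" for v
  proof -
    have "v \<in> W_span l 0 \<and> f v \<in> W_span l j"
      using that
    proof (rule W_span_induct)
      show "fock.subspace {v. v \<in> W_span l 0 \<and> f v \<in> W_span l j}"
        by (rule fock.subspaceI)
           (auto simp: f0 add scale fock.subspace_0[OF subspace_W_span] fock.subspace_add[OF subspace_W_span] fock.subspace_scale[OF subspace_W_span])
      fix M assume M: "?ok M"
      then have "?ok (image_mset (shift j) M)" by (simp only: colours_shift)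
      then show "W_vec l 0 M \<in> W_span l 0 \<and> f (W_vec l 0 M) \<in> W_span l j"
        using W_vec_W_span[OF M] f'[OF M] fock.subspace_scale[OF subspace_W_span W_vec_W_span]
        by (auto simp: fock.subspace_0[OF subspace_W_span] simp del: set_image_mset)
    qed
    then show ?thesis ..
  qed
  have lin_f: "linear_between (W_span l 0) (W_span l j) f"
    using into by (auto simp: linear_between_def add scale)
  have e_eq: "?e = (*) (expo (simple_root j - fund_weight l j))" by (rule ext) (rule exp_mult_eq)
  \<comment> \<open>Adding the exponent \<open>alpha_j - lambda_j\<close> replaces
    \<open>lambda_j\<close> by \<open>alpha_j\<close>, exactly the weight of an extra factor
    \<open>(j, 0)\<close>, which as a ring element is 1.\<close>
  have e: "?e (W_vec l j M) = W_vec l 0 (add_mset (j, 0) M)" for M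
  proof -
    have "expo (simple_root j - fund_weight l j) * expo (root_sum (colours M) + fund_weight l j) = expo (root_sum (colours M) + simple_root j)"
      by (simp add: expo_mult algebra_simps)
    then show ?thesis by (simp add: e_eq W_vec_def Hprod_add_mset root_sum_add_mset mult.left_commute)
  qed
  have lin_e: "fock_linear ?e" unfolding e_eq by (rule fock_linear_mult)
  have e_W_span: "?e ` W_span l j = fock.span (?e ` W_vec l j ` {M. ?ok M})"
    unfolding W_span_def by (rule fock_pair.linear_span_image[OF lin_e, symmetric])
  have sub_e: "fock.subspace (?e ` W_span l j)" unfolding e_W_span by simp
  have sub_ker: "fock.subspace {b \<in> W_span l 0. f b = 0}"
    by (rule fock.subspaceI)
       (auto simp: f0 add scale fock.subspace_0[OF subspace_W_span] fock.subspace_add[OF subspace_W_span] fock.subspace_scale[OF subspace_W_span])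
  have le: "?e ` W_span l j \<subseteq> {b \<in> W_span l 0. f b = 0}"
    unfolding e_W_span
  proof (rule fock.span_minimal[OF _ sub_ker], clarify)
    fix M assume "?ok M"
    then have "?ok (add_mset (j, 0) M)" using j by simp
    then show "?e (W_vec l j M) \<in> W_span l 0 \<and> f (?e (W_vec l j M)) = 0"
      unfolding e using f'[of "add_mset (j, 0) M"] W_vec_W_span[of "add_mset (j, 0) M" l 0] by simp
  qed
  have ge: "{b \<in> W_span l 0. f b = 0} \<subseteq> ?e ` W_span l j"
  proof clarify
    fix v assume v: "v \<in> W_span l 0" "f v = 0"
    from span_image_sum[OF v(1)[unfolded W_span_def]] obtain F a
      where F: "finite F" "F \<subseteq> {M. ?ok M}" and v_eq: "v = (\<Sum>M\<in>F. scale (a M) (W_vec l 0 M))" by blast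
    \<comment> \<open>Only terms without \<open>(j, 0)\<close> survive under \<open>f\<close>, and
      on them the shift is injective, so independence can be applied to their images.\<close>
    define F2 where "F2 = {M \<in> F. (j, 0) \<notin># M}"
    have F2: "finite F2" "F2 \<subseteq> F" using F by (auto simp: F2_def)
    have inj: "inj_on (image_mset (shift j)) F2"
      by (rule inj_on_inverseI[of _ "image_mset (unshift j)"]) (simp add: F2_def unshift_shift)
    have "0 = (\<Sum>M\<in>F. scale (a M) (f (W_vec l 0 M)))"
      using fsum[OF F(1), of a] F(2) v by (auto simp: v_eq)
    also have "\<dots> = (\<Sum>M\<in>F2. scale (a M) (f (W_vec l 0 M)))"
      by (rule sum.mono_neutral_right) (use F F2 f' in \<open>auto simp: F2_def\<close>)
    also have "\<dots> = (\<Sum>M\<in>F2. scale (a M * c (colours M)) (W_vec l j (image_mset (shift j) M)))"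
      by (rule sum.cong) (use F f' in \<open>auto simp: F2_def\<close>)
    also have "\<dots> = (\<Sum>M\<in>image_mset (shift j) ` F2. scale (a (image_mset (unshift j) M) * c (colours M)) (W_vec l j M))"
      by (subst sum.reindex[OF inj]) (auto simp: F2_def unshift_shift simp flip: image_mset.compositionality)
    finally have sum0: "(\<Sum>M\<in>image_mset (shift j) ` F2. scale (a (image_mset (unshift j) M) * c (colours M))
        (Hprod l M * expo (root_sum (colours M) + fund_weight l j))) = 0"
      by (simp add: W_vec_def)
    have ok: "?ok M" if M: "M \<in> image_mset (shift j) ` F2" for M
    proof -
      obtain M1 where "M1 \<in> F2" "M = image_mset (shift j) M1" using M by blast
      moreover from this(1) have "?ok M1" using F F2 by blast
      ultimately show ?thesis by (simp only: colours_shift)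
    qed
    have zero: "a (image_mset (unshift j) M) * c (colours M) = 0" if "M \<in> image_mset (shift j) ` F2" for M
      by (rule Hprod_independent[where a = "\<lambda>M. a (image_mset (unshift j) M) * c (colours M)",
            OF finite_imageI[OF F2(1)] ok sum0 that])
    have "a M = 0" if "M \<in> F2" for M
    proof -
      have "(j, 0) \<notin># M" "?ok M" using that F by (auto simp: F2_def)
      then show ?thesis
        using zero[OF imageI[OF that]] c[of "colours M"] by (simp add: unshift_shift)
    qed
    \<comment> \<open>What remains consists of terms with a factor \<open>(j, 0)\<close>, each the
      image of the term with one such factor removed.\<close>
    then have "v = (\<Sum>M\<in>F - F2. scale (a M) (W_vec l 0 M))"
      unfolding v_eq by (intro sum.mono_neutral_right) (use F in auto)
    also have "\<dots> \<in> ?e ` W_span l j"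
    proof (intro fock.subspace_sum[OF sub_e] fock.subspace_scale[OF sub_e])
      fix M assume "M \<in> F - F2"
      then have "(j, 0) \<in># M" "?ok M" using F by (auto simp: F2_def)
      then obtain M' where M: "M = add_mset (j, 0) M'" by (metis mset_add)
      have "W_vec l 0 M = ?e (W_vec l j M')" unfolding M e ..
      moreover have "W_vec l j M' \<in> W_span l j" using \<open>?ok M\<close> by (intro W_vec_W_span) (simp add: M)
      ultimately show "W_vec l 0 M \<in> ?e ` W_span l j" by blast
    qed
    finally show "v \<in> ?e ` W_span l j" .
  qed
  have inj_e: "inj_on ?e (W_span l j)"
  proof (rule inj_on_inverseI)
    show "expo (- (simple_root j - fund_weight l j)) * ?e v = v" for v
      by (simp only: e_eq mult.assoc[symmetric] expo_mult) (simp add: expo_0)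
  qed
  have surj: "W_span l j \<subseteq> f ` W_span l 0"
  proof
    fix v assume "v \<in> W_span l j"
    then show "v \<in> f ` W_span l 0"
    proof (rule W_span_induct)
      have "fock.subspace (f ` W_span l 0)"
      proof (rule fock.subspaceI)
        show "0 \<in> f ` W_span l 0" using f0 fock.subspace_0[OF subspace_W_span] by force
        show "x + y \<in> f ` W_span l 0" if "x \<in> f ` W_span l 0" "y \<in> f ` W_span l 0" for x y
          using that fock.subspace_add[OF subspace_W_span] by (auto simp flip: add)
        show "scale c x \<in> f ` W_span l 0" if "x \<in> f ` W_span l 0" for c x
          using that fock.subspace_scale[OF subspace_W_span] by (auto simp flip: scale)
      qed
      then show "fock.subspace {v. v \<in> f ` W_span l 0}" by simp
      fix M assume M: "?ok M"
      \<comment> \<open>Raising every index of colour \<open>j\<close> gives a preimage up to the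
        scalar; it has no factor \<open>(j, 0)\<close>, so \<open>f\<close> does not kill
        it.\<close>
      let ?M = "image_mset (unshift j) M"
      from M have ok: "?ok ?M" by (simp only: colours_unshift)
      have "f (scale (1 / c (colours M)) (W_vec l 0 ?M)) = W_vec l j M"
        using scale[OF W_vec_W_span[OF ok]] f'[OF ok] c[OF M] not_mem_unshift[of j M] by (simp add: shift_unshift)
      moreover have "scale (1 / c (colours M)) (W_vec l 0 ?M) \<in> W_span l 0"
        by (intro fock.subspace_scale[OF subspace_W_span] W_vec_W_span ok)
      ultimately show "W_vec l j M \<in> f ` W_span l 0" by (metis imageI)
    qed
  qed
  show ?thesis
    unfolding short_exact_def
  proof (intro conjI)
    show "linear_between (W_span l j) (W_span l 0) ?e"
      using le by (auto simp: linear_between_def fock_pair.linear_add[OF lin_e] fock_pair.linear_scale[OF lin_e])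
    show "f ` W_span l 0 = W_span l j" using into surj by blast
  qed (use le ge lin_f inj_e in auto)
qed

section \<open>The two intertwining maps\<close>

lemma Dop_one: "Dop l j {#} 1 = 1"
  by (simp add: Dop_def)

text \<open>The empty monomial has the empty list as its only enumeration, which settles the choice
  in \<open>vop\<close>.\<close>

lemma vop_expo: "vop l \<epsilon> (expo \<xi>) r v = vop_exp l \<epsilon> \<xi> r v"
  by (simp add: vop_def expo_def)

lemma lin_ext_graded:
  assumes "v \<in> graded 0 \<beta>"
  shows "lin_ext (\<lambda>\<mu> \<beta>. scale (g \<beta>) (basis_vec \<mu> \<beta>)) v = scale (g \<beta>) v"
proof -
  have "scale (g \<beta>) v = (\<Sum>b \<in> Poly_Mapping.keys v. scale (g \<beta>) (scale (Poly_Mapping.lookup v b) (basis_vec (fst b) (snd b))))"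
    by (subst fock_expansion) (simp only: fock.scale_sum_right)
  also have "\<dots> = lin_ext (\<lambda>\<mu> \<beta>. scale (g \<beta>) (basis_vec \<mu> \<beta>)) v"
    unfolding lin_ext_def by (rule sum.cong) (use assms in \<open>auto simp: graded_def mult.commute\<close>)
  finally show ?thesis ..
qed

lemma W_vec_graded: "set_mset (colours M) \<subseteq> {1..l} \<Longrightarrow> W_vec l j M \<in> graded 0 (root_sum (colours M) + fund_weight l j)"
  using graded_mult[OF Hprod_graded expo_graded] unfolding W_vec_def by fastforce

text \<open>In the constant term the creation index is \<open>q - k\<close>, where \<open>k\<close>
  is the number of factors of colour \<open>j\<close>. It is negative for \<open>q < k\<close>, and
  the annihilation coefficient vanishes for \<open>q > k\<close>; only \<open>q = k\<close> is left,
  with creation part 1.\<close>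

lemma std_intertwiner_W_vec:
  assumes j: "j \<in> {1..l}" and M: "set_mset (colours M) \<subseteq> {1..l}"
  shows "std_intertwiner l \<epsilon> j (hw_vec l j) 0 (W_vec l 0 M)
   = scale (exp (\<i> * of_real pi * form l (fund_weight l j) (root_sum (colours M)))
        * commutator_map \<epsilon> (root_sum (colours M)) (fund_weight l j) * \<epsilon> (fund_weight l j) (root_sum (colours M))
        * (- 1) ^ count (colours M) j)
      (Dop l j (colours M) (Hprod l M) * expo (root_sum (colours M) + fund_weight l j))"
proof -
  let ?K = "colours M" and ?L = "fund_weight l j"
  let ?k = "count ?K j" and ?g = "\<lambda>\<beta>. exp (\<i> * of_real pi * form l ?L \<beta>) * commutator_map \<epsilon> \<beta> ?L"
  have gr: "W_vec l 0 M \<in> graded 0 (root_sum ?K)" using W_vec_graded[OF M, of 0] by simp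
  have "0 - form l ?L (root_sum ?K) = of_int (- int ?k)"
    using form_fund_weight_root_sum[OF j M] by simp
  from eventually_conj[OF vop_exp_eq[OF gr this, of \<epsilon>] eventually_ge_at_top[of ?k]]
  obtain N where N: "?k \<le> N" and vop: "vop_exp l \<epsilon> ?L 0 (W_vec l 0 M)
    = scale (\<epsilon> ?L (root_sum ?K)) ((\<Sum>q\<le>N. Hz l ?L (- int ?k + int q) * E_plus l ?L q (W_vec l 0 M)) * expo ?L)"
    using eventually_happens by fastforce
  have E: "E_plus l ?L q (W_vec l 0 M) = E_plus l ?L q (Hprod l M) * expo (root_sum ?K)" for q
    by (simp add: W_vec_def E_plus_mult_expo)
  have "(\<Sum>q\<le>N. Hz l ?L (- int ?k + int q) * E_plus l ?L q (W_vec l 0 M))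
      = (\<Sum>q\<in>{?k}. Hz l ?L (- int ?k + int q) * E_plus l ?L q (W_vec l 0 M))"
  proof (rule sum.mono_neutral_right)
    show "\<forall>q\<in>{..N} - {?k}. Hz l ?L (- int ?k + int q) * E_plus l ?L q (W_vec l 0 M) = 0"
    proof
      fix q assume "q \<in> {..N} - {?k}"
      then consider "q < ?k" | "?k < q" by force
      then show "Hz l ?L (- int ?k + int q) * E_plus l ?L q (W_vec l 0 M) = 0"
      proof cases
        case 2
        from E_plus_fund_weight_eq_0[OF j M Hprod_Hspan[OF refl lessI] this] show ?thesis by (simp add: E)
      qed (simp add: Hz_def)
    qed
  qed (use N in auto)
  also have "\<dots> = scale ((- 1) ^ ?k) (Dop l j ?K (Hprod l M) * expo (root_sum ?K))"
    by (simp add: Hz_def E Dop_def scale_mult_left flip: power_mult_distrib)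
  finally have "vop_exp l \<epsilon> ?L 0 (W_vec l 0 M)
      = scale (\<epsilon> ?L (root_sum ?K) * (- 1) ^ ?k) (Dop l j ?K (Hprod l M) * expo (root_sum ?K + ?L))"
    by (simp add: vop scale_mult_left mult.assoc expo_mult)
  moreover have "std_intertwiner l \<epsilon> j (hw_vec l j) 0 (W_vec l 0 M) = vop_exp l \<epsilon> ?L 0 (scale (?g (root_sum ?K)) (W_vec l 0 M))"
    using lin_ext_graded[OF gr, of ?g] by (simp add: std_intertwiner_def hw_vec_def vop_expo[unfolded expo_def])
  ultimately show ?thesis
    by (simp only: fock_pair.linear_scale[OF fock_linear_vop_exp] fock.scale_scale mult.assoc)
qed

lemma fock_linear_std_intertwiner: "fock_linear (std_intertwiner l \<epsilon> j (hw_vec l j) k)"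
proof -
  have "fock_linear (\<lambda>v. vop_exp l \<epsilon> (fund_weight l j) (of_int k)
     (lin_ext (\<lambda>\<mu> \<beta>. scale (exp (\<i> * of_real pi * form l (fund_weight l j) \<beta>)
        * commutator_map \<epsilon> \<beta> (fund_weight l j)) (basis_vec \<mu> \<beta>)) v))"
    by (rule fock_linear_compose[OF fock_linear_vop_exp fock_linear_lin_ext])
  moreover have "std_intertwiner l \<epsilon> j (hw_vec l j) k = (\<lambda>v. vop_exp l \<epsilon> (fund_weight l j) (of_int k)
     (lin_ext (\<lambda>\<mu> \<beta>. scale (exp (\<i> * of_real pi * form l (fund_weight l j) \<beta>)
        * commutator_map \<epsilon> \<beta> (fund_weight l j)) (basis_vec \<mu> \<beta>)) v))"
    by (rule ext) (simp add: std_intertwiner_def hw_vec_def vop_expo[unfolded expo_def])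
  ultimately show ?thesis by simp
qed

lemma std_intertwiner_exact:
  assumes j: "j \<in> {1..l}" and \<epsilon>: "lattice_cocycle l N \<epsilon>"
  shows "\<exists>s. scale s (std_intertwiner l \<epsilon> j (hw_vec l j) 0 (hw_vec l 0)) = hw_vec l j \<and>
           short_exact (W_span l j) (exp_mult (simple_root j - fund_weight l j)) (W_span l 0)
             (\<lambda>v. scale s (std_intertwiner l \<epsilon> j (hw_vec l j) 0 v)) (W_span l j)"
proof -
  let ?L = "fund_weight l j" and ?I = "std_intertwiner l \<epsilon> j (hw_vec l j) 0"
  define c where "c K = exp (\<i> * of_real pi * form l ?L (root_sum K)) * commutator_map \<epsilon> (root_sum K) ?L * \<epsilon> ?L (root_sum K) * (- 1) ^ count K j" for K
  have c: "c K \<noteq> 0" if "set_mset K \<subseteq> {1..l}" for K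
    using cocycle_nonzero[OF \<epsilon> root_sum_weight_lattice[OF that] fund_weight_weight_lattice[of j l]]
      cocycle_nonzero[OF \<epsilon> fund_weight_weight_lattice[of j l] root_sum_weight_lattice[OF that]] j
    by (simp add: c_def commutator_map_def)
  have I: "?I (W_vec l 0 M) = scale (c (colours M)) (Dop l j (colours M) (Hprod l M) * expo (root_sum (colours M) + ?L))"
    if "set_mset (colours M) \<subseteq> {1..l}" for M
    using std_intertwiner_W_vec[OF j that] by (simp add: c_def)
  have "?I (hw_vec l 0) = scale (c {#}) (hw_vec l j)"
    using I[of "{#}"] by (simp add: hw_vec_eq W_vec_def Dop_one)
  \<comment> \<open>The normalizing scalar is the inverse of the factor at weight 0.\<close>
  then have "scale (1 / c {#}) (?I (hw_vec l 0)) = hw_vec l j" using c[of "{#}"] by simp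
  moreover have "short_exact (W_span l j) (exp_mult (simple_root j - ?L)) (W_span l 0) (\<lambda>v. scale (1 / c {#}) (?I v)) (W_span l j)"
  proof (rule short_exact_W_span[OF j, where c = "\<lambda>K. 1 / c {#} * c K"])
    show "1 / c {#} * c K \<noteq> 0" if "set_mset K \<subseteq> {1..l}" for K using c that by simp
  qed (simp_all add: I fock_pair.linear_add[OF fock_linear_std_intertwiner]
      fock_pair.linear_scale[OF fock_linear_std_intertwiner] fock.scale_right_distrib mult.commute)
  ultimately show ?thesis by blast
qed

section \<open>Consequences of the axioms for an arbitrary intertwining operator\<close>

lemma W_span_std_module: "W_span l j \<subseteq> std_module l j"
proof -
  \<comment> \<open>The coset condition on weights is left out so that the set is closed under
    multiplication; it is added at the end.\<close>
  let ?R = "{v :: fock. \<forall>b \<in> Poly_Mapping.keys v. set_mset (fst b) \<subseteq> {1..l} \<times> {1..}}"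
  have R: "fock.subspace ?R" by (rule subspace_keys)
  have mult: "v * w \<in> ?R" if "v \<in> ?R" "w \<in> ?R" for v w
  proof -
    have "Poly_Mapping.keys (v * w) \<subseteq> {a + b | a b. a \<in> Poly_Mapping.keys v \<and> b \<in> Poly_Mapping.keys w}"
      by (rule keys_mult)
    with that show ?thesis by fastforce
  qed
  have bas: "basis_vec \<mu> \<beta> \<in> ?R" if "set_mset \<mu> \<subseteq> {1..l} \<times> {1..}" for \<mu> \<beta>
    using that by (simp add: basis_vec_def)
  have one: "1 \<in> ?R" using bas[of "{#}" 0] by (simp add: basis_vec_one)
  have Hx: "Hx l (simple_root i) n \<in> ?R" if i: "i \<in> {1..l}" for i n
  proof (induction n rule: less_induct)
    case (less n)
    show ?case
    proof (cases "n = 0")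
      case False
      have "scale (1 / of_nat n) (of_nat n * Hx l (simple_root i) n) \<in> ?R"
        unfolding Hx_rec hneg_simple_root[OF i] gen_def
        by (intro fock.subspace_scale[OF R] fock.subspace_sum[OF R] mult bas less) (use i in auto)
      then show ?thesis using False by (simp add: scale_of_nat[symmetric])
    qed (use one in simp)
  qed
  have Hprod: "Hprod l M \<in> ?R" if "set_mset (colours M) \<subseteq> {1..l}" for M
    using that
  proof (induction M)
    case empty
    then show ?case using one by simp
  next
    case (add x M)
    obtain i n where x: "x = (i, n)" by force
    have "Hx l (simple_root i) n * Hprod l M \<in> ?R" using add by (intro mult Hx) (auto simp: x)
    then show ?case by (simp only: x Hprod_add_mset)
  qed
  have S: "fock.subspace (std_module l j)"
    unfolding std_module_def by (rule subspace_keys)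
  show ?thesis
    unfolding W_span_def
  proof (rule fock.span_minimal[OF _ S], clarify)
    fix M assume M: "set_mset (colours M) \<subseteq> {1..l}"
    have "W_vec l j M \<in> ?R" unfolding W_vec_def expo_def by (intro mult Hprod M bas) simp
    then have "set_mset (fst b) \<subseteq> {1..l} \<times> {1..} \<and> (\<exists>\<gamma>\<in>root_lattice l. snd b = \<gamma> + fund_weight l j)"
      if "b \<in> Poly_Mapping.keys (W_vec l j M)" for b
      using that root_sum_root_lattice[OF M] W_vec_graded[OF M, of j] unfolding graded_def by blast
    then show "W_vec l j M \<in> std_module l j"
      unfolding std_module_def case_prod_unfold by blast
  qed
qed

text \<open>As \<open><alpha, lambda_j>\<close> is nonnegative, the creation index is negative at
  \<open>q = 0\<close>, while the annihilation series kills 1 for \<open>q > 0\<close>.\<close>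

lemma root_op_hw_vec_eq_0:
  assumes "j \<le> l" "\<alpha> \<in> pos_roots l"
  shows "root_op l \<epsilon> \<alpha> (int i) (hw_vec l j) = 0"
proof -
  obtain A where A: "\<alpha> = root_sum A" "set_mset A \<subseteq> {1..l}" using pos_rootsE[OF assms(2)] .
  obtain b :: nat where b: "form l \<alpha> (fund_weight l j) = of_int (int b)"
  proof (cases "j = 0")
    case False
    with assms have "form l (fund_weight l j) (root_sum A) = of_int (int (count A j))"
      using form_fund_weight_root_sum[of j l A] A by simp
    then show ?thesis using that by (simp add: A(1) form_sym[of l "root_sum A"])
  qed (use that[of 0] in simp)
  obtain N where "root_op l \<epsilon> \<alpha> (int i) (1 * expo (fund_weight l j))
    = scale (\<epsilon> \<alpha> (fund_weight l j)) ((\<Sum>q\<le>N. Hz l \<alpha> (- int i - 1 - int b + int q) * E_plus l \<alpha> q 1) * expo (fund_weight l j + \<alpha>))"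
    using eventually_happens[OF root_op_eq[OF one_graded b]] by auto
  moreover have "Hz l \<alpha> (- int i - 1 - int b + int q) * E_plus l \<alpha> q 1 = 0" for q
    by (simp add: E_plus_one Hz_def)
  ultimately show ?thesis by (simp add: hw_vec_def expo_def)
qed

lemma Sum_any_single:
  assumes "\<And>i. i \<noteq> a \<Longrightarrow> f i = 0"
  shows "Sum_any f = f a"
  using Sum_any.expand_superset[of "{a}" f] assms by auto

text \<open>The coefficient \<open>k = 0\<close> of the Jacobi identity is the commutator formula, whose right-hand
  side involves only \<open>x\<^sub>\<alpha>(i) v\<^bsub>\<Lambda>\<^sub>j\<^esub>\<close> with \<open>i \<ge> 0\<close>.\<close>

lemma intertwining_operator_commutes:
  assumes Z: "intertwining_operator l \<epsilon> (std_module l j) (std_module l 0) (std_module l j) Z"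
    and j: "j \<le> l" and \<alpha>: "\<alpha> \<in> pos_roots l" and v: "v \<in> std_module l 0"
  shows "Z (hw_vec l j) 0 (root_op l \<epsilon> \<alpha> m v) = root_op l \<epsilon> \<alpha> m (Z (hw_vec l j) 0 v)"
proof -
  obtain A where A: "\<alpha> = root_sum A" "set_mset A \<subseteq> {1..l}" using pos_rootsE[OF \<alpha>] .
  have u: "expo \<alpha> \<in> std_module l 0"
    using root_sum_root_lattice[OF A(2)] by (auto simp: std_module_def expo_def basis_vec_def A(1))
  have hw: "hw_vec l j \<in> std_module l j"
    using W_span_std_module[of l j] W_vec_W_span[of "{#}" l j] by (auto simp: hw_vec_eq)
  have U: "vop l \<epsilon> (expo \<alpha>) (of_int (- a - 1)) = root_op l \<epsilon> \<alpha> a" for a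
    by (rule ext) (simp add: vop_expo root_op_def)
  have Z0: "Z 0 k v = 0" for k
  proof -
    have "linear_between (std_module l j) (std_module l j) (\<lambda>w. Z w k v)"
      using Z v unfolding intertwining_operator_def by blast
    then have "Z (scale 0 (hw_vec l j)) k v = scale 0 (Z (hw_vec l j) k v)"
      using hw unfolding linear_between_def by blast
    then show ?thesis by simp
  qed
  have "jacobi_identity l \<epsilon> Z (expo \<alpha>) (hw_vec l j) v"
    using Z u hw v unfolding intertwining_operator_def by blast
  \<comment> \<open>With \<open>n = -1\<close> the mode of \<open>Z\<close> at \<open>i = 0\<close>
    is the coefficient of \<open>x^0\<close>, and with \<open>k = 0\<close> both sums on the left
    reduce to \<open>i = 0\<close>.\<close>
  then have "Sum_any (\<lambda>i :: nat. scale ((- 1) ^ i * (of_int 0 gchoose i))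
            (root_op l \<epsilon> \<alpha> (0 + m - int i) (Z (hw_vec l j) (- (- 1 + int i) - 1) v)))
        - Sum_any (\<lambda>i :: nat. scale ((- 1) powi 0 * (- 1) ^ i * (of_int 0 gchoose i))
            (Z (hw_vec l j) (- (0 + - 1 - int i) - 1) (root_op l \<epsilon> \<alpha> (m + int i) v)))
      = Sum_any (\<lambda>i :: nat. scale (of_int m gchoose i)
            (Z (root_op l \<epsilon> \<alpha> (0 + int i) (hw_vec l j)) (- (m + - 1 - int i) - 1) v))"
    unfolding jacobi_identity_def Let_def U by blast
  moreover have "(0 gchoose i) = (0 :: complex)" if "i \<noteq> 0" for i
    using that by (cases i) auto
  ultimately have "root_op l \<epsilon> \<alpha> m (Z (hw_vec l j) 0 v) - Z (hw_vec l j) 0 (root_op l \<epsilon> \<alpha> m v) = 0"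
    by (subst (asm) Sum_any_single[of 0], simp, subst (asm) Sum_any_single[of 0], simp)
       (simp add: root_op_hw_vec_eq_0[OF j \<alpha>] Z0)
  then show ?thesis by simp
qed

text \<open>Both the constant term and \<open>Dop\<close> are compatible with the modes of
  \<open>x_{alpha_i}\<close>: the annihilation series of \<open>alpha_i\<close> and
  \<open>lambda_j\<close> commute, and the index drop in \<open>Dop_Hz\<close> equals the extra
  exponent \<open><alpha_i, lambda_j>\<close> at the target. Hence they remain proportional when
  \<open>i\<close> is added to \<open>K\<close>, and the factor changes by a ratio of cocycle
  values.\<close>

lemma intertwining_operator_Hspan:
  assumes Z: "intertwining_operator l \<epsilon> (std_module l j) (std_module l 0) (std_module l j) Z"
    and hw: "Z (hw_vec l j) 0 (hw_vec l 0) = hw_vec l j"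
    and j: "j \<in> {1..l}" and \<epsilon>: "lattice_cocycle l N \<epsilon>" and K: "set_mset K \<subseteq> {1..l}"
  shows "\<exists>c. c \<noteq> 0 \<and> (\<forall>d. \<forall>u \<in> Hspan l K d.
     Z (hw_vec l j) 0 (u * expo (root_sum K)) = scale c (Dop l j K u * expo (root_sum K + fund_weight l j)))"
  using K
proof (induction K)
  let ?F = "Z (hw_vec l j) 0" and ?L = "fund_weight l j"
  have lin: "linear_between (std_module l 0) (std_module l j) ?F"
    using Z W_span_std_module[of l j] W_vec_W_span[of "{#}" l j] by (auto simp: intertwining_operator_def hw_vec_eq)
  have W: "v \<in> std_module l 0" if "v \<in> W_span l 0" for v using that W_span_std_module by blast
  have F_add: "?F (v + w) = ?F v + ?F w" and F_scale: "?F (scale c v) = scale c (?F v)"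
    if "v \<in> W_span l 0" "w \<in> W_span l 0" for v w c
    using lin W[OF that(1)] W[OF that(2)] by (auto simp: linear_between_def)
  have F0: "?F 0 = 0" using F_scale[of 0 0 0] fock.subspace_0[OF subspace_W_span] by auto
  \<comment> \<open>Membership in \<open>W_span l 0\<close> is part of the set because the constant
    term is known to be linear only on the module.\<close>
  have sub: "fock.subspace {v \<in> W_span l 0. ?F v = g v}" if "fock_linear g" for g
    by (rule fock.subspaceI)
       (auto simp: F_add F_scale F0 fock_pair.linear_0[OF that] fock_pair.linear_add[OF that] fock_pair.linear_scale[OF that]
         fock.subspace_0[OF subspace_W_span] fock.subspace_add[OF subspace_W_span] fock.subspace_scale[OF subspace_W_span])
  have lin_g: "fock_linear (\<lambda>v. scale c (Dop l j K v * expo ?L))" for c K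
    by (rule fock_linear_compose[OF fock_linear_scale fock_linear_compose[OF fock_linear_mult' fock_linear_Dop]])
  have Dop_expo: "Dop l j K (u * expo \<beta>) = Dop l j K u * expo \<beta>" for K u \<beta>
    by (simp add: Dop_def E_plus_mult_expo scale_mult_left)
  {
    case empty
    have "?F u = Dop l j {#} u * expo ?L" if "u \<in> Hspan l {#} d" for u d
    proof -
      have "u \<in> {v \<in> W_span l 0. ?F v = scale 1 (Dop l j {#} v * expo ?L)}"
        using that
      proof (rule Hspan_induct)
        show "fock.subspace {u. u \<in> {v \<in> W_span l 0. ?F v = scale 1 (Dop l j {#} v * expo ?L)}}"
          unfolding Collect_mem_eq by (rule sub[OF lin_g])
        have "1 \<in> W_span l 0" using W_vec_W_span[of "{#}" l 0] by (simp add: W_vec_def expo_0)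
        then show "Hprod l M \<in> {v \<in> W_span l 0. ?F v = scale 1 (Dop l j {#} v * expo ?L)}" if "colours M = {#}" for M
          using that hw by (simp add: hw_vec_eq W_vec_def expo_0 Dop_one)
      qed
      then show ?thesis by simp
    qed
    then show ?case by (intro exI[of _ 1]) (auto simp: expo_0)
  next
    case (add i K)
    then have K: "set_mset K \<subseteq> {1..l}" and i: "i \<in> {1..l}" by auto
    let ?\<alpha> = "simple_root i" and ?\<gamma> = "root_sum K" and ?K = "add_mset i K"
    obtain c where c: "c \<noteq> 0" and IH: "\<And>d u. u \<in> Hspan l K d \<Longrightarrow> ?F (u * expo ?\<gamma>) = scale c (Dop l j K u * expo (?\<gamma> + ?L))"
      using add.IH K by blast
    have nz: "\<epsilon> ?\<alpha> (?\<gamma> + ?L) \<noteq> 0" "\<epsilon> ?\<alpha> ?\<gamma> \<noteq> 0"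
      using j cocycle_nonzero[OF \<epsilon> simple_root_weight_lattice[OF i] weight_mem[OF K, of j]]
        cocycle_nonzero[OF \<epsilon> simple_root_weight_lattice[OF i] root_sum_weight_lattice[OF K]] by auto
    \<comment> \<open>The root operator brings in \<open>\<epsilon>\<close> at the source weight on
      one side and at the target weight on the other.\<close>
    define c' where "c' = c * \<epsilon> ?\<alpha> (?\<gamma> + ?L) / \<epsilon> ?\<alpha> ?\<gamma>"
    let ?g = "\<lambda>v. scale c' (Dop l j ?K v * expo ?L)"
    obtain b where b: "form l ?\<alpha> ?\<gamma> = of_int b"
      using form_simple_root_weight[of 0 l i K] i by auto
    have b': "form l ?\<alpha> (?\<gamma> + ?L) = of_int (b + of_bool (i = j))"
      using form_fund_weight_simple_root[OF j i] by (auto simp: form_add_right b form_sym[of l ?\<alpha> ?L])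
    have op: "root_op l \<epsilon> ?\<alpha> m (u * expo ?\<gamma>) \<in> {v \<in> W_span l 0. ?F v = ?g v}" if u: "u \<in> Hspan l K d" for u d m
    proof -
      have uW: "u * expo ?\<gamma> \<in> W_span l 0" using Hspan_W_span[OF K u, of 0] by simp
      define t where "t = - m - 1 - b"
      let ?E = "E_plus l ?\<alpha>" and ?H = "Hz l ?\<alpha>" and ?D = "Dop l j K u"
      have Dgr: "?D \<in> graded 0 0"
        unfolding Dop_def by (rule fock.subspace_scale[OF subspace_graded Hspan_graded[OF K E_plus_Hspan[OF K u]]])
      have t': "- m - 1 - (b + of_bool (i = j)) = t - of_bool (i = j)" by (simp add: t_def)
      obtain N where
        N1: "root_op l \<epsilon> ?\<alpha> m (u * expo ?\<gamma>) = scale (\<epsilon> ?\<alpha> ?\<gamma>) ((\<Sum>q\<le>N. ?H (t + int q) * ?E q u) * expo (?\<gamma> + ?\<alpha>))" and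
        N2: "root_op l \<epsilon> ?\<alpha> m (?D * expo (?\<gamma> + ?L)) =
           scale (\<epsilon> ?\<alpha> (?\<gamma> + ?L)) ((\<Sum>q\<le>N. ?H (t - of_bool (i = j) + int q) * ?E q ?D) * expo (?\<gamma> + ?L + ?\<alpha>))"
        using eventually_happens[OF eventually_conj[OF root_op_eq[OF Hspan_graded[OF K u] b, of \<epsilon> m]
            root_op_eq[OF Dgr b', of \<epsilon> m]]] unfolding t_def[symmetric] t' by auto
      have DE: "?E q ?D = Dop l j K (?E q u)" for q
        by (simp only: Dop_def fock_pair.linear_scale[OF fock_linear_E_plus] E_plus_commute[of l ?\<alpha>])
      have D: "Dop l j ?K (?H (t + int q) * ?E q u) = ?H (t - of_bool (i = j) + int q) * ?E q ?D" for q
        unfolding DE Dop_Hz[OF j i K E_plus_Hspan[OF K u]] by (simp add: algebra_simps)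
      have "?F (root_op l \<epsilon> ?\<alpha> m (u * expo ?\<gamma>)) = root_op l \<epsilon> ?\<alpha> m (?F (u * expo ?\<gamma>))"
        using j i by (intro intertwining_operator_commutes[OF Z _ _ W[OF uW]] simple_root_pos_roots) auto
      also have "\<dots> = scale c (root_op l \<epsilon> ?\<alpha> m (?D * expo (?\<gamma> + ?L)))"
        by (simp only: IH[OF u] fock_pair.linear_scale[OF fock_linear_root_op])
      also have "\<dots> = scale (c * \<epsilon> ?\<alpha> (?\<gamma> + ?L)) ((\<Sum>q\<le>N. Dop l j ?K (?H (t + int q) * ?E q u)) * expo (?\<gamma> + ?L + ?\<alpha>))"
        by (simp add: N2 D)
      also have "\<dots> = scale (c * \<epsilon> ?\<alpha> (?\<gamma> + ?L)) (Dop l j ?K ((\<Sum>q\<le>N. ?H (t + int q) * ?E q u) * expo (?\<gamma> + ?\<alpha>)) * expo ?L)"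
        by (simp only: fock_pair.linear_sum[OF fock_linear_Dop] Dop_expo mult.assoc expo_mult
            add.assoc add.commute[of ?L])
      also have "\<dots> = ?g (root_op l \<epsilon> ?\<alpha> m (u * expo ?\<gamma>))"
        using nz by (simp add: N1 fock_pair.linear_scale[OF fock_linear_Dop] scale_mult_left c'_def)
      finally show ?thesis
        using root_op_W_span[OF _ simple_root_pos_roots[OF i] uW] by simp
    qed
    have "?F (u * expo (root_sum ?K)) = scale c' (Dop l j ?K u * expo (root_sum ?K + ?L))" if "u \<in> Hspan l ?K d" for u d
    proof -
      have "u * expo (?\<gamma> + ?\<alpha>) \<in> {v \<in> W_span l 0. ?F v = ?g v}"
        by (rule Hprod_mem[where \<epsilon> = \<epsilon>, OF sub[OF lin_g] K b nz(2) _ that]) (rule op)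
      then show ?thesis by (simp add: root_sum_add_mset Dop_expo mult.assoc expo_mult)
    qed
    moreover have "c' \<noteq> 0" using c nz by (simp add: c'_def)
    ultimately show ?case by blast
  }
qed

lemma intertwining_operator_exact:
  assumes Z: "intertwining_operator l \<epsilon> (std_module l j) (std_module l 0) (std_module l j) Z"
    and hw: "Z (hw_vec l j) 0 (hw_vec l 0) = hw_vec l j"
    and j: "j \<in> {1..l}" and \<epsilon>: "lattice_cocycle l N \<epsilon>"
  shows "short_exact (W_span l j) (exp_mult (simple_root j - fund_weight l j)) (W_span l 0) (Z (hw_vec l j) 0) (W_span l j)"
proof -
  have "\<forall>K. \<exists>c. set_mset K \<subseteq> {1..l} \<longrightarrow> c \<noteq> 0 \<and> (\<forall>d. \<forall>u \<in> Hspan l K d.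
     Z (hw_vec l j) 0 (u * expo (root_sum K)) = scale c (Dop l j K u * expo (root_sum K + fund_weight l j)))"
    using intertwining_operator_Hspan[OF assms] by blast
  then obtain c where c: "\<And>K. set_mset K \<subseteq> {1..l} \<Longrightarrow> c K \<noteq> 0 \<and> (\<forall>d. \<forall>u \<in> Hspan l K d.
     Z (hw_vec l j) 0 (u * expo (root_sum K)) = scale (c K) (Dop l j K u * expo (root_sum K + fund_weight l j)))"
    by metis
  have lin: "linear_between (std_module l 0) (std_module l j) (Z (hw_vec l j) 0)"
    using Z W_span_std_module[of l j] W_vec_W_span[of "{#}" l j] by (auto simp: intertwining_operator_def hw_vec_eq)
  have W: "v \<in> std_module l 0" if "v \<in> W_span l 0" for v using that W_span_std_module by blast
  show ?thesis
  proof (rule short_exact_W_span[OF j, where c = c])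
    show "Z (hw_vec l j) 0 (v + w) = Z (hw_vec l j) 0 v + Z (hw_vec l j) 0 w" if "v \<in> W_span l 0" "w \<in> W_span l 0" for v w
      using lin W[OF that(1)] W[OF that(2)] unfolding linear_between_def by blast
    show "Z (hw_vec l j) 0 (scale a v) = scale a (Z (hw_vec l j) 0 v)" if "v \<in> W_span l 0" for a v
      using lin W[OF that] unfolding linear_between_def by blast
    show "Z (hw_vec l j) 0 (W_vec l 0 M) = scale (c (colours M)) (Dop l j (colours M) (Hprod l M) * expo (root_sum (colours M) + fund_weight l j))"
      if "set_mset (colours M) \<subseteq> {1..l}" for M
      using c[OF that] Hprod_Hspan[OF refl lessI, of l M] by (simp add: W_vec_def)
  qed (use c in blast)
qed

theorem theorem2:
  fixes l j N :: nat and \<epsilon> :: "cartan \<Rightarrow> cartan \<Rightarrow> complex"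
  assumes "l \<ge> 2" and "j \<in> {1..l}" and "lattice_cocycle l N \<epsilon>"
  shows "(\<forall>Z. intertwining_operator l \<epsilon> (std_module l j) (std_module l 0) (std_module l j) Z \<and>
             Z (hw_vec l j) 0 (hw_vec l 0) = hw_vec l j \<longrightarrow>
           short_exact
             (principal_subspace l \<epsilon> j) (exp_mult (simple_root j - fund_weight l j))
             (principal_subspace l \<epsilon> 0) (Z (hw_vec l j) 0)
             (principal_subspace l \<epsilon> j)) \<and>
         (\<exists>s. scale s (std_intertwiner l \<epsilon> j (hw_vec l j) 0 (hw_vec l 0)) = hw_vec l j \<and>
           short_exact
             (principal_subspace l \<epsilon> j) (exp_mult (simple_root j - fund_weight l j))
             (principal_subspace l \<epsilon> 0) (\<lambda>v. scale s (std_intertwiner l \<epsilon> j (hw_vec l j) 0 v))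
             (principal_subspace l \<epsilon> j))"
proof -
  have "principal_subspace l \<epsilon> 0 = W_span l 0" "principal_subspace l \<epsilon> j = W_span l j"
    using assms by (auto intro!: principal_subspace_eq)
  then show ?thesis
    using intertwining_operator_exact[OF _ _ assms(2,3)] std_intertwiner_exact[OF assms(2,3)] by auto
qed

end
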